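(* Let $\Delta_n$ be a uniform flag triangulation of the boundary $\partial P_n$ of the root polytope belonging to the Simion class such that pairs of arrows of type $THTH$ nest and pairs of type $HTHT$ do not nest. Then for $i\ge1$ the number of facets of $\Delta_n$ consisting of $i$ forward arrows and $n-i$ backward arrows is $$f(\Delta_n,i,n-i)=2^{i-1}\cdot\frac{(i+1)\,(2n-i)!}{(n-i)!\,(n+1)!},$$ and the number of facets consisting of no forward arrows and $n$ backward arrows is the Catalan number $C_n$.
   Context: $P_n$ is the convex hull of $e_j-e_i$ ($i\ne j$) in $\mathbb{R}^{n+1}$. An arrow $(i,j)$, $i\ne j\in\{1,\dots,n+1\}$, with tail $i$ and head $j$, is identified with $e_j-e_i$; it is forward if $i<j$, backward if $i>j$; $V_n$ is the set of arrows. A uniform flag triangulation of $\partial P_n$ is a flag simplicial complex on $V_n$ representing a triangulation of $\partial P_n$ (without new vertices) in which whether a pair $\{(i_1,j_1),(i_2,j_2)\}$ is an edge depends only on the equalities and inequalities among $i_1,i_2,j_1,j_2$. For two arrows with four distinct endpoints $p_1<\dots<p_4$ the type is the $T/H$ word recording tails/heads at $p_1,\dots,p_4$; the pair nests if it joins $\{p_1,p_4\},\{p_2,p_3\}$, crosses if it joins $\{p_1,p_3\},\{p_2,p_4\}$; "type $W$ nests" means nesting pairs of type $W$ are edges, "does not nest" that they are not; similarly for crossing. The Simion class: exactly one of $THTH$, $HTHT$ nests, and if both $THHT$ and $HTTH$ cross then both $TTHH$ and $HHTT$ nest. $f(\Delta_n,i,j)$ is the number of faces with $i$ forward and $j$ backward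 arrows. *)

theory Defs
  imports "HOL-Analysis.Analysis"
begin

text \<open>The arrow with tail \<open>i\<close> and head \<open>j\<close> is the pair \<open>(i, j)\<close>.\<close>

type_synonym arrow = "nat \<times> nat"

definition arrows :: "nat \<Rightarrow> arrow set" where
  "arrows n = {(i, j). i \<in> {1..n+1} \<and> j \<in> {1..n+1} \<and> i \<noteq> j}"

definition forward :: "arrow \<Rightarrow> bool" where
  "forward a \<longleftrightarrow> fst a < snd a"

definition backward :: "arrow \<Rightarrow> bool" where
  "backward a \<longleftrightarrow> snd a < fst a"

text \<open>Throughout, \<open>e\<close> is meant to enumerate, over \<open>{1..n+1}\<close>, the standard basis of an
  \<open>(n+1)\<close>-dimensional Euclidean space; this is assumed wherever \<open>e\<close> is used.\<close>

definition arrow_vec :: "(nat \<Rightarrow> 'a::euclidean_space) \<Rightarrow> arrow \<Rightarrow> 'a" where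
  "arrow_vec e a = e (snd a) - e (fst a)"

definition root_polytope :: "(nat \<Rightarrow> 'a::euclidean_space) \<Rightarrow> nat \<Rightarrow> 'a set" where
  "root_polytope e n = convex hull (arrow_vec e ` arrows n)"

definition abstract_complex :: "'v set \<Rightarrow> 'v set set \<Rightarrow> bool" where
  "abstract_complex V \<Delta> \<longleftrightarrow>
     \<Delta> \<subseteq> {\<sigma>. \<sigma> \<subseteq> V \<and> finite \<sigma>} \<and> {} \<in> \<Delta> \<and> (\<forall>v\<in>V. {v} \<in> \<Delta>) \<and>
     (\<forall>\<sigma>\<in>\<Delta>. \<forall>\<tau>. \<tau> \<subseteq> \<sigma> \<longrightarrow> \<tau> \<in> \<Delta>)"

definition flag_complex :: "'v set \<Rightarrow> 'v set set \<Rightarrow> bool" where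
  "flag_complex V \<Delta> \<longleftrightarrow> abstract_complex V \<Delta> \<and>
     (\<forall>\<sigma>. \<sigma> \<subseteq> V \<and> finite \<sigma> \<and> (\<forall>v\<in>\<sigma>. \<forall>w\<in>\<sigma>. v \<noteq> w \<longrightarrow> {v, w} \<in> \<Delta>) \<longrightarrow> \<sigma> \<in> \<Delta>)"

text \<open>The polytope has dimension \<open>n\<close> in an \<open>(n+1)\<close>-dimensional space, so its boundary is the
  relative frontier. Affine independence is required separately: \<^const>\<open>simplicial_complex\<close>
  alone would allow the convex hull of a face to be a simplex on fewer vertices.\<close>

definition triangulates_boundary ::
    "(nat \<Rightarrow> 'a::euclidean_space) \<Rightarrow> nat \<Rightarrow> arrow set set \<Rightarrow> bool" where
  "triangulates_boundary e n \<Delta> \<longleftrightarrow>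
     (\<forall>\<sigma>\<in>\<Delta>. \<not> affine_dependent (arrow_vec e ` \<sigma>)) \<and>
     simplicial_complex ((\<lambda>\<sigma>. convex hull (arrow_vec e ` \<sigma>)) ` \<Delta>) \<and>
     (\<Union>\<sigma>\<in>\<Delta>. convex hull (arrow_vec e ` \<sigma>)) = rel_frontier (root_polytope e n)"

definition same_order :: "nat list \<Rightarrow> nat list \<Rightarrow> bool" where
  "same_order xs ys \<longleftrightarrow> length xs = length ys \<and>
     (\<forall>k<length xs. \<forall>l<length xs.
        (xs ! k < xs ! l \<longleftrightarrow> ys ! k < ys ! l) \<and> (xs ! k = xs ! l \<longleftrightarrow> ys ! k = ys ! l))"

definition uniform :: "nat \<Rightarrow> arrow set set \<Rightarrow> bool" where
  "uniform n \<Delta> \<longleftrightarrow>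
     (\<forall>a\<in>arrows n. \<forall>b\<in>arrows n. \<forall>a'\<in>arrows n. \<forall>b'\<in>arrows n.
        same_order [fst a, snd a, fst b, snd b] [fst a', snd a', fst b', snd b'] \<longrightarrow>
        ({a, b} \<in> \<Delta> \<longleftrightarrow> {a', b'} \<in> \<Delta>))"

definition uniform_flag_triangulation ::
    "(nat \<Rightarrow> 'a::euclidean_space) \<Rightarrow> nat \<Rightarrow> arrow set set \<Rightarrow> bool" where
  "uniform_flag_triangulation e n \<Delta> \<longleftrightarrow>
     flag_complex (arrows n) \<Delta> \<and> triangulates_boundary e n \<Delta> \<and> uniform n \<Delta>"

datatype mark = T | H

definition ends :: "arrow \<Rightarrow> nat set" where
  "ends a = {fst a, snd a}"

definition word_at :: "arrow \<Rightarrow> arrow \<Rightarrow> nat list \<Rightarrow> mark list" where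
  "word_at a b ps = map (\<lambda>p. if p \<in> {fst a, fst b} then T else H) ps"

definition nesting_pair :: "mark list \<Rightarrow> arrow \<Rightarrow> arrow \<Rightarrow> bool" where
  "nesting_pair W a b \<longleftrightarrow>
     (\<exists>p1 p2 p3 p4. p1 < p2 \<and> p2 < p3 \<and> p3 < p4 \<and>
        {ends a, ends b} = {{p1, p4}, {p2, p3}} \<and> word_at a b [p1, p2, p3, p4] = W)"

definition crossing_pair :: "mark list \<Rightarrow> arrow \<Rightarrow> arrow \<Rightarrow> bool" where
  "crossing_pair W a b \<longleftrightarrow>
     (\<exists>p1 p2 p3 p4. p1 < p2 \<and> p2 < p3 \<and> p3 < p4 \<and>
        {ends a, ends b} = {{p1, p3}, {p2, p4}} \<and> word_at a b [p1, p2, p3, p4] = W)"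

definition type_nests :: "nat \<Rightarrow> arrow set set \<Rightarrow> mark list \<Rightarrow> bool" where
  "type_nests n \<Delta> W \<longleftrightarrow>
     (\<forall>a\<in>arrows n. \<forall>b\<in>arrows n. nesting_pair W a b \<longrightarrow> {a, b} \<in> \<Delta>)"

definition type_does_not_nest :: "nat \<Rightarrow> arrow set set \<Rightarrow> mark list \<Rightarrow> bool" where
  "type_does_not_nest n \<Delta> W \<longleftrightarrow>
     (\<forall>a\<in>arrows n. \<forall>b\<in>arrows n. nesting_pair W a b \<longrightarrow> {a, b} \<notin> \<Delta>)"

definition type_crosses :: "nat \<Rightarrow> arrow set set \<Rightarrow> mark list \<Rightarrow> bool" where
  "type_crosses n \<Delta> W \<longleftrightarrow>
     (\<forall>a\<in>arrows n. \<forall>b\<in>arrows n. crossing_pair W a b \<longrightarrow> {a, b} \<in> \<Delta>)"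

text \<open>For \<open>n < 3\<close> there are no pairs of arrows with four distinct endpoints, so a type vacuously
  both nests and does not nest. Spelling out ``exactly one nests'' as below keeps the small cases
  in the class; for \<open>n \<ge> 3\<close> and a uniform complex it is the exclusive disjunction.\<close>

definition simion_class :: "nat \<Rightarrow> arrow set set \<Rightarrow> bool" where
  "simion_class n \<Delta> \<longleftrightarrow>
     ((type_nests n \<Delta> [T, H, T, H] \<and> type_does_not_nest n \<Delta> [H, T, H, T]) \<or>
      (type_nests n \<Delta> [H, T, H, T] \<and> type_does_not_nest n \<Delta> [T, H, T, H])) \<and>
     (type_crosses n \<Delta> [T, H, H, T] \<and> type_crosses n \<Delta> [H, T, T, H] \<longrightarrow>
      type_nests n \<Delta> [T, T, H, H] \<and> type_nests n \<Delta> [H, H, T, T])"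

definition faces_with :: "arrow set set \<Rightarrow> nat \<Rightarrow> nat \<Rightarrow> arrow set set" where
  "faces_with \<Delta> i j =
     {\<sigma>\<in>\<Delta>. card {a\<in>\<sigma>. forward a} = i \<and> card {a\<in>\<sigma>. backward a} = j}"

definition face_number :: "arrow set set \<Rightarrow> nat \<Rightarrow> nat \<Rightarrow> nat" where
  "face_number \<Delta> i j = card (faces_with \<Delta> i j)"

definition facets :: "'v set set \<Rightarrow> 'v set set" where
  "facets \<Delta> = {\<sigma>\<in>\<Delta>. \<forall>\<tau>\<in>\<Delta>. \<sigma> \<subseteq> \<tau> \<longrightarrow> \<tau> = \<sigma>}"

definition catalan :: "nat \<Rightarrow> real" where
  "catalan n = real ((2 * n) choose n) / real (n + 1)"

end

theory Submission
  imports Defs "HOL-Computational_Algebra.Polynomial"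
begin

text \<open>Since the triangulation is unimodular and complete, every integer vector with coordinate sum 0
  is in exactly one way a positive integer combination of the arrows of a face. By the Simion
  conditions all forward arrows of a face pass over a common gap that no backward arrow of the face
  passes over; hence the total multiplicity of the forward arrows is the largest prefix sum (tails
  minus heads) of the vector, whatever the triangulation. Writing the vector as a difference of two
  weak compositions turns a weighted sum of the numbers \<open>f(\<Delta>, i, j)\<close> into a ballot-type count of pairs
  of weak compositions, which is a product formula in binomial coefficients. The numbers
  \<open>f(\<Delta>, i, n - i)\<close> are the leading coefficients of the resulting polynomial identity.\<close>

section \<open>Pairs of weak compositions\<close>

text \<open>The triangulation is known only through local edge rules, so its facets cannot be
  listed; the count has to go through a statistic that the vector alone determines. A prefix sum of
  a net flow is the forward weight over a gap minus the backward weight over it, so it never exceeds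
  the total forward weight, and the common gap attains this bound. In a pair of compositions with
  common total \<open>M + a\<close>, the number \<open>a\<close> is the forward weight, and
  \<open>M\<close> collects the backward weight and the pointwise minimum, which supplies
  \<open>n + 1\<close> free variables. A face with I forward and J backward arrows then carries
  \<open>((a - 1) choose (I - 1)) * ((M + n) choose (n + J))\<close> labellings if I and
  \<open>a\<close> are positive. Its degree in \<open>a\<close> and \<open>M\<close> together is n +
  I + J - 1, which is at most 2n - 1, with equality exactly for I + J = n. Along
  \<open>M = N\<close>, \<open>a = p * N\<close> the limit of large \<open>N\<close> keeps only
  these faces, and the power of \<open>p\<close> tells the values of I apart. Faces without forward
  arrows are seen at \<open>a = 0\<close>, in degree 2n.\<close>

definition weak_comps :: "nat \<Rightarrow> nat \<Rightarrow> nat list set" where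
  "weak_comps L s = {ks. length ks = L \<and> sum_list ks = s}"

text \<open>A walk with up-steps \<open>ks\<close> and down-steps \<open>js\<close> gets to height
  \<open>c\<close>. The additive form avoids truncated subtraction at negative heights. The empty
  prefix makes \<open>c = 0\<close> always true, so only positive heights carry information.\<close>

definition reaches :: "nat \<Rightarrow> nat list \<Rightarrow> nat list \<Rightarrow> bool" where
  "reaches c ks js \<longleftrightarrow> (\<exists>r\<le>length ks. sum_list (take r js) + c \<le> sum_list (take r ks))"

text \<open>The two totals are independent parameters because deleting the first column lowers them
  by different amounts.\<close>

definition reaching_pairs :: "nat \<Rightarrow> nat \<Rightarrow> nat \<Rightarrow> nat \<Rightarrow> (nat list \<times> nat list) set" where
  "reaching_pairs L c x y =
     {(ks, js). ks \<in> weak_comps L x \<and> js \<in> weak_comps L y \<and> reaches c ks js}"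

lemma finite_weak_comps [simp]: "finite (weak_comps L s)"
proof (rule finite_subset)
  show "weak_comps L s \<subseteq> {ks. set ks \<subseteq> {..s} \<and> length ks = L}"
    by (auto simp: weak_comps_def member_le_sum_list)
qed (simp add: finite_lists_length_eq)

lemma card_weak_comps: "card (weak_comps (Suc n) s) = (s + n) choose n"
  using card_length_sum_list[of "Suc n" s] binomial_symmetric[of s "s + n"]
  by (simp add: weak_comps_def)

lemma finite_reaching_pairs [simp]: "finite (reaching_pairs L c x y)"
  by (rule finite_subset[of _ "weak_comps L x \<times> weak_comps L y"]) (auto simp: reaching_pairs_def)

lemma reaches_mono:
  assumes "reaches d' ks js" "d \<le> d'"
  shows "reaches d ks js"
proof -
  from assms(1) obtain r where "r \<le> length ks" "sum_list (take r js) + d' \<le> sum_list (take r ks)"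
    by (auto simp: reaches_def)
  then show ?thesis using assms(2) by (auto simp: reaches_def intro!: exI[of _ r])
qed

text \<open>Positivity of \<open>c\<close> excludes the empty prefix, so the first column is always
  used; after it, the missing height is \<open>c + j - k\<close>.\<close>

lemma reaches_Cons:
  assumes "c > 0"
  shows "reaches c (k # ks) (j # js) \<longleftrightarrow> j + c \<le> k \<or> reaches (c + j - k) ks js"
proof
  assume "reaches c (k # ks) (j # js)"
  then obtain r where r: "r \<le> Suc (length ks)"
      "sum_list (take r (j # js)) + c \<le> sum_list (take r (k # ks))"
    by (auto simp: reaches_def)
  with assms obtain q where "r = Suc q" by (cases r) auto
  with r show "j + c \<le> k \<or> reaches (c + j - k) ks js"
    by (auto simp: reaches_def intro!: exI[of _ q])
next
  assume "j + c \<le> k \<or> reaches (c + j - k) ks js"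
  then show "reaches c (k # ks) (j # js)"
  proof
    assume "j + c \<le> k"
    then show ?thesis by (auto simp: reaches_def intro!: exI[of _ 1])
  next
    assume "reaches (c + j - k) ks js"
    then obtain q where "q \<le> length ks" "sum_list (take q js) + (c + j - k) \<le> sum_list (take q ks)"
      by (auto simp: reaches_def)
    then show ?thesis by (auto simp: reaches_def intro!: exI[of _ "Suc q"])
  qed
qed

text \<open>Classification by the first column. A column that attains the height at once leaves the
  remaining entries unrestricted, which explains the product of two \<open>weak_comps\<close>
  counts.\<close>

lemma card_reaching_pairs_Suc:
  assumes "c > 0"
  shows "card (reaching_pairs (Suc L) c x y) =
    (\<Sum>j\<le>y. \<Sum>k\<le>x. if j + c \<le> k then card (weak_comps L (x - k)) * card (weak_comps L (y - j))
       else card (reaching_pairs L (c + j - k) (x - k) (y - j)))"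
proof -
  define tails where "tails = (\<lambda>(j, k). if j + c \<le> k then weak_comps L (x - k) \<times> weak_comps L (y - j)
      else reaching_pairs L (c + j - k) (x - k) (y - j))"
  have fin: "finite (tails p)" for p
    by (auto simp: tails_def split: prod.splits)
  define f :: "(nat \<times> nat) \<times> nat list \<times> nat list \<Rightarrow> nat list \<times> nat list"
    where "f = (\<lambda>((j, k), ks, js). (k # ks, j # js))"
  have "bij_betw f (Sigma ({..y} \<times> {..x}) tails) (reaching_pairs (Suc L) c x y)"
  proof (rule bij_betwI')
    fix p q
    show "f p = f q \<longleftrightarrow> p = q" by (auto simp: f_def split: prod.splits)
  next
    fix p assume "p \<in> Sigma ({..y} \<times> {..x}) tails"
    then show "f p \<in> reaching_pairs (Suc L) c x y"
      using assms
      by (auto simp: f_def tails_def reaching_pairs_def weak_comps_def reaches_Cons split: if_splits)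
  next
    fix p assume "p \<in> reaching_pairs (Suc L) c x y"
    then obtain k ks j js where p: "p = (k # ks, j # js)" "length ks = L" "length js = L"
      "k + sum_list ks = x" "j + sum_list js = y" "reaches c (k # ks) (j # js)"
      by (auto simp: reaching_pairs_def weak_comps_def length_Suc_conv)
    then have "((j, k), ks, js) \<in> Sigma ({..y} \<times> {..x}) tails"
      using assms by (auto simp: tails_def reaching_pairs_def weak_comps_def reaches_Cons)
    moreover have "p = f ((j, k), ks, js)" by (simp add: f_def p)
    ultimately show "\<exists>q\<in>Sigma ({..y} \<times> {..x}) tails. p = f q" by blast
  qed
  then have "card (reaching_pairs (Suc L) c x y) = card (Sigma ({..y} \<times> {..x}) tails)"
    by (simp add: bij_betw_same_card)
  also have "\<dots> = (\<Sum>p\<in>{..y} \<times> {..x}. card (tails p))"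
    using fin by (subst card_SigmaI) auto
  also have "\<dots> = (\<Sum>j\<le>y. \<Sum>k\<le>x. card (tails (j, k)))"
    by (simp add: sum.cartesian_product)
  also have "\<dots> = (\<Sum>j\<le>y. \<Sum>k\<le>x. if j + c \<le> k
      then card (weak_comps L (x - k)) * card (weak_comps L (y - j))
       else card (reaching_pairs L (c + j - k) (x - k) (y - j)))"
    by (intro sum.cong refl) (auto simp: tails_def card_cartesian_product)
  finally show ?thesis .
qed

section \<open>Hockey-stick sums and the ballot-type product formula\<close>

lemma sum_choose_descending:
  "(\<Sum>k\<le>Y. (Y - k + n) choose n) = (Y + Suc n) choose Suc n"
proof -
  have "(\<Sum>k\<le>Y. (Y - k + n) choose n) = (\<Sum>k\<le>Y. (k + n) choose n)"
    by (rule sum.reindex_bij_witness[of _ "\<lambda>k. Y - k" "\<lambda>k. Y - k"]) auto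
  also have "\<dots> = (Y + Suc n) choose Suc n"
    by (induction Y) auto
  finally show ?thesis .
qed

text \<open>The hockey-stick sum stopped after \<open>K\<close> terms, with the unsummed rest as one
  binomial. For \<open>n = 0\<close> the lower index should be -1; truncation would turn it into 0
  and the term into 1, so the value 0 is prescribed.\<close>

lemma sum_choose_partial:
  assumes "K \<le> Y"
  shows "(\<Sum>k<K. if n = 0 then 0 else (Y - k + n - 1) choose (n - 1)) + ((Y - K + n) choose n)
    = (Y + n) choose n"
  using assms
proof (induction K)
  case (Suc K)
  show ?case
  proof (cases n)
    case (Suc p)
    obtain d where "Y = Suc (K + d)"
      using Suc.prems by (metis add_Suc le_Suc_ex)
    then show ?thesis using Suc.IH Suc by (simp add: add.assoc)
  qed simp
qed simp

text \<open>A reflection-type formula: the product counts weak compositions of \<open>x - c\<close>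
  into \<open>n + 2\<close> parts and of \<open>y + c\<close> into \<open>n\<close> parts, as if one
  part and the amount \<open>c\<close> changed sides in opposite directions. The hypothesis
  \<open>x < y + c\<close> says that the walk ends below the height it has to reach.\<close>

lemma card_reaching_pairs:
  assumes "c > 0" "x < y + c"
  shows "card (reaching_pairs (Suc n) c x y) =
    (if c \<le> x then ((x - c + Suc n) choose Suc n) * (if n = 0 then 0 else (y + c + n - 1) choose (n - 1)) else 0)"
  using assms
proof (induction n arbitrary: c x y)
  case 0
  \<comment> \<open>With a single column, reaching \<open>c\<close> would mean
    \<open>y + c \<le> x\<close>.\<close>
  have "reaching_pairs (Suc 0) c x y = {}"
    using 0 by (auto simp: reaching_pairs_def weak_comps_def length_Suc_conv reaches_Cons)
      (auto simp: reaches_def)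
  then show ?case by simp
next
  case (Suc n)
  let ?D = "\<lambda>Y. if n = 0 then 0 else (Y + n - 1) choose (n - 1)"
  let ?t = "\<lambda>j k. if j + c \<le> k then ((x - k + n) choose n) * ((y - j + n) choose n)
      else if j + c \<le> x then ((x - c - j + Suc n) choose Suc n) * ?D (y + c - k) else 0"
  have "card (reaching_pairs (Suc (Suc n)) c x y) = (\<Sum>j\<le>y. \<Sum>k\<le>x. ?t j k)"
  proof (subst card_reaching_pairs_Suc[OF Suc.prems(1)], intro sum.cong refl)
    fix j k assume jk: "j \<in> {..y}" "k \<in> {..x}"
    show "(if j + c \<le> k then card (weak_comps (Suc n) (x - k)) * card (weak_comps (Suc n) (y - j))
        else card (reaching_pairs (Suc n) (c + j - k) (x - k) (y - j))) = ?t j k"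
    proof (cases "j + c \<le> k")
      case False
      \<comment> \<open>The induction hypothesis applies because \<open>x < y + c\<close> compares
        final height and target, and deleting a column shifts both equally.\<close>
      have "card (reaching_pairs (Suc n) (c + j - k) (x - k) (y - j)) = 
         (if c + j - k \<le> x - k then ((x - k - (c + j - k) + Suc n) choose Suc n) *
           (if n = 0 then 0 else (y - j + (c + j - k) + n - 1) choose (n - 1)) else 0)"
        using False jk Suc.prems by (intro Suc.IH) auto
      moreover have "c + j - k \<le> x - k \<longleftrightarrow> j + c \<le> x" using False jk by auto
      moreover have "y - j + (c + j - k) = y + c - k" using False jk by auto
      moreover have "x - k - (c + j - k) = x - c - j" using False jk by auto
      ultimately show ?thesis using False by simp
    qed (simp add: card_weak_comps)
  qed
  also have "\<dots> = (\<Sum>j\<le>y. if j + c \<le> x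
      then ((x - c - j + Suc n) choose Suc n) * ((y + c + n) choose n) else 0)"
  proof (intro sum.cong refl)
    fix j assume j: "j \<in> {..y}"
    show "(\<Sum>k\<le>x. ?t j k) = (if j + c \<le> x
      then ((x - c - j + Suc n) choose Suc n) * ((y + c + n) choose n) else 0)"
    proof (cases "j + c \<le> x")
      case True
      \<comment> \<open>For small \<open>k\<close> the first factor is free of \<open>k\<close>; for
        the other \<open>k\<close> the second factor is, and the sum of the first equals that same
        binomial. What remains is a partial hockey-stick sum whose value no longer depends on
        \<open>j\<close>.\<close>
      have split: "{..x} = {..<j + c} \<union> {j + c..x}" using True by auto
      have "(\<Sum>k\<le>x. ?t j k) = (\<Sum>k<j+c. ?t j k) + (\<Sum>k=j+c..x. ?t j k)"
        unfolding split by (rule sum.union_disjoint) auto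
      also have "(\<Sum>k<j+c. ?t j k) = ((x - c - j + Suc n) choose Suc n) * (\<Sum>k<j+c. ?D (y + c - k))"
        using True by (subst sum_distrib_left) (intro sum.cong refl, auto)
      also have "(\<Sum>k=j+c..x. ?t j k) = ((y - j + n) choose n) * (\<Sum>k=j+c..x. (x - k + n) choose n)"
        using True by (subst sum_distrib_left) (intro sum.cong refl, auto)
      also have "(\<Sum>k=j+c..x. (x - k + n) choose n) = (\<Sum>k\<le>x-c-j. (x - c - j - k + n) choose n)"
        by (rule sum.reindex_bij_witness[of _ "\<lambda>k. k + (j + c)" "\<lambda>k. k - (j + c)"]) (use True in auto)
      also have "\<dots> = (x - c - j + Suc n) choose Suc n"
        by (rule sum_choose_descending)
      finally have "(\<Sum>k\<le>x. ?t j k) = ((x - c - j + Suc n) choose Suc n) *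
          ((\<Sum>k<j+c. ?D (y + c - k)) + ((y - j + n) choose n))"
        by (simp add: algebra_simps)
      moreover have "(\<Sum>k<j+c. ?D (y + c - k)) + ((y - j + n) choose n) = (y + c + n) choose n"
        using sum_choose_partial[of "j + c" "y + c" n] j by simp
      ultimately show ?thesis using True by simp
    qed (auto intro!: sum.neutral)
  qed
  also have "\<dots> = (\<Sum>j\<in>{j. j \<le> y \<and> j + c \<le> x}.
      ((x - c - j + Suc n) choose Suc n) * ((y + c + n) choose n))"
    by (subst sum.inter_filter[symmetric]) (auto intro!: sum.cong)
  \<comment> \<open>The bound \<open>j \<le> y\<close> follows from \<open>j + c \<le> x\<close> and
    \<open>x < y + c\<close>.\<close>
  also have "{j. j \<le> y \<and> j + c \<le> x} = (if c \<le> x then {..x - c} else {})"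
    using Suc.prems by auto
  finally have "card (reaching_pairs (Suc (Suc n)) c x y) = (if c \<le> x then
      (\<Sum>j\<le>x-c. (x - c - j + Suc n) choose Suc n) * ((y + c + n) choose n) else 0)"
    by (simp only: sum_distrib_right sum.empty split: if_split) simp
  then show ?case
    unfolding sum_choose_descending by simp
qed

section \<open>Forward arrows and prefix sums\<close>

text \<open>Tails minus heads is the negative of the coordinate of the combination of the vectors
  \<open>arrow_vec\<close>. With this sign, forward arrows contribute positively to prefix
  sums.\<close>

definition net_flow :: "arrow set \<Rightarrow> (arrow \<Rightarrow> 'b::ab_group_add) \<Rightarrow> nat \<Rightarrow> 'b" where
  "net_flow \<sigma> lab l = (\<Sum>a | a \<in> \<sigma> \<and> fst a = l. lab a) - (\<Sum>a | a \<in> \<sigma> \<and> snd a = l. lab a)"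

text \<open>What the assumed edge rules leave possible inside one face: no head of an arrow is a tail of
  another, \<open>THTH\<close> pairs nest, \<open>HTHT\<close> pairs do not, and (second Simion condition) if both mixed
  crossings occur then no two forward and no two backward arrows cross.\<close>

definition alternating_nonseparated :: "arrow set \<Rightarrow> bool" where
  "alternating_nonseparated \<sigma> \<longleftrightarrow>
     (\<forall>p q r. (p, q) \<in> \<sigma> \<longrightarrow> (q, r) \<notin> \<sigma>) \<and>
     (\<forall>p1 p2 p3 p4. p1 < p2 \<and> p2 < p3 \<and> p3 < p4 \<longrightarrow>
        \<not> ((p1, p2) \<in> \<sigma> \<and> (p3, p4) \<in> \<sigma>) \<and> \<not> ((p4, p1) \<in> \<sigma> \<and> (p2, p3) \<in> \<sigma>))"

definition crossing_restricted :: "arrow set \<Rightarrow> bool" where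
  "crossing_restricted \<sigma> \<longleftrightarrow>
     (\<exists>p1 p2 p3 p4. p1 < p2 \<and> p2 < p3 \<and> p3 < p4 \<and> (p1, p3) \<in> \<sigma> \<and> (p4, p2) \<in> \<sigma>) \<and>
     (\<exists>p1 p2 p3 p4. p1 < p2 \<and> p2 < p3 \<and> p3 < p4 \<and> (p3, p1) \<in> \<sigma> \<and> (p2, p4) \<in> \<sigma>) \<longrightarrow>
     (\<forall>p1 p2 p3 p4. p1 < p2 \<and> p2 < p3 \<and> p3 < p4 \<longrightarrow>
        \<not> ((p1, p3) \<in> \<sigma> \<and> (p2, p4) \<in> \<sigma>) \<and> \<not> ((p3, p1) \<in> \<sigma> \<and> (p4, p2) \<in> \<sigma>))"

text \<open>Forward arrows overlap pairwise, so the gaps between their largest tail \<open>A\<close>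
  and their least head \<open>B\<close> lie under all of them. If a backward arrow passed over each
  of these gaps, those over the two extreme gaps would produce both mixed crossings, since no
  backward arrow encloses a forward one. Then crossings of equal direction are forbidden, and
  backward arrows cannot cover the range from \<open>A\<close> to \<open>B\<close> without two of
  them crossing.\<close>

lemma common_forward_gap:
  assumes fin: "finite \<sigma>" and alt: "alternating_nonseparated \<sigma>" and cr: "crossing_restricted \<sigma>"
    and fwd: "(p0, q0) \<in> \<sigma>" "p0 < q0"
  obtains k where "\<And>p q. (p, q) \<in> \<sigma> \<Longrightarrow> p < q \<Longrightarrow> p \<le> k \<and> k < q"
    and "\<And>p q. (p, q) \<in> \<sigma> \<Longrightarrow> q \<le> k \<Longrightarrow> p \<le> k"
proof -
  have no_path: "q \<noteq> p'" if "(p, q) \<in> \<sigma>" "(p', r) \<in> \<sigma>" for p q p' r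
    using alt that unfolding alternating_nonseparated_def by blast
  have no_sep: "\<not> q < p'" if "(p, q) \<in> \<sigma>" "(p', q') \<in> \<sigma>" "p < q" "p' < q'" for p q p' q'
    using alt that unfolding alternating_nonseparated_def by blast
  have no_cover: "\<not> (q < p' \<and> q' < p)" if "(p, q) \<in> \<sigma>" "(p', q') \<in> \<sigma>" "p' < q'" for p q p' q'
    using alt that unfolding alternating_nonseparated_def by blast
  define tails where "tails = {p. \<exists>q. (p, q) \<in> \<sigma> \<and> p < q}"
  define heads where "heads = {q. \<exists>p. (p, q) \<in> \<sigma> \<and> p < q}"
  have "tails \<subseteq> fst ` \<sigma>" "heads \<subseteq> snd ` \<sigma>"
    by (force simp: tails_def heads_def)+
  then have fin_th: "finite tails" "finite heads"
    using fin by (auto intro: finite_subset)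
  have ne: "tails \<noteq> {}" "heads \<noteq> {}" using fwd by (auto simp: tails_def heads_def)
  define A where "A = Max tails"
  define B where "B = Min heads"
  have "A \<in> tails" "B \<in> heads" using fin_th ne by (simp_all add: A_def B_def)
  then obtain \<beta> \<alpha> where ab: "(A, \<beta>) \<in> \<sigma>" "A < \<beta>" "(\<alpha>, B) \<in> \<sigma>" "\<alpha> < B"
    by (auto simp: tails_def heads_def)
  have le: "p \<le> A \<and> B \<le> q" if "(p, q) \<in> \<sigma>" "p < q" for p q
    using fin_th that by (auto simp: A_def B_def tails_def heads_def intro!: Max_ge Min_le)
  have "A < B"
    using no_sep[OF ab(3) ab(1)] no_path[OF ab(3) ab(1)] ab by auto
  show ?thesis
  proof (cases "\<exists>k. A \<le> k \<and> k < B \<and> (\<forall>(p, q)\<in>\<sigma>. q \<le> k \<longrightarrow> p \<le> k)")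
    case True
    then obtain k where k: "A \<le> k" "k < B" "\<And>p q. (p, q) \<in> \<sigma> \<Longrightarrow> q \<le> k \<Longrightarrow> p \<le> k"
      by blast
    show ?thesis
      by (rule that[of k]) (use k le in fastforce)+
  next
    case False
    then have covered: "\<exists>p q. (q, p) \<in> \<sigma> \<and> p \<le> k \<and> k < q" if "A \<le> k" "k < B" for k
      using that by force
    \<comment> \<open>The backward arrow over \<open>A\<close> that extends farthest to the right is
      selected; the gap at its tail \<open>q\<close> will give the contradiction.\<close>
    define Q where "Q = {q. \<exists>p. (q, p) \<in> \<sigma> \<and> p < A \<and> A < q}"
    have "Q \<subseteq> fst ` \<sigma>" by (force simp: Q_def)
    then have finQ: "finite Q" using fin by (auto intro: finite_subset)
    obtain p1 q1 where "(q1, p1) \<in> \<sigma>" "p1 \<le> A" "A < q1"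
      using covered[of A] \<open>A < B\<close> by blast
    then have "q1 \<in> Q"
      using no_path[OF _ ab(1), of q1 p1] by (force simp: Q_def)
    define q where "q = Max Q"
    have "q \<in> Q" unfolding q_def using finQ \<open>q1 \<in> Q\<close> by (intro Max_in) auto
    then obtain p where pq: "(q, p) \<in> \<sigma>" "p < A" "A < q" by (auto simp: Q_def)
    \<comment> \<open>A backward arrow around the tail \<open>A\<close> must end inside every
      forward arrow leaving \<open>A\<close>, otherwise it would enclose that arrow.\<close>
    have below: "s < \<gamma>" if "(s, r) \<in> \<sigma>" "r < A" "A < s" "(A, \<gamma>) \<in> \<sigma>" "A < \<gamma>" for r s \<gamma>
      using no_cover[OF that(1,4)] no_path[OF that(4,1)] that by auto
    have c1: "\<exists>p1 p2 p3 p4. p1 < p2 \<and> p2 < p3 \<and> p3 < p4 \<and> (p3, p1) \<in> \<sigma> \<and> (p2, p4) \<in> \<sigma>"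
      using pq ab below[OF pq ab(1,2)] by blast
    have "A \<le> B - 1" "B - 1 < B" using \<open>A < B\<close> by linarith+
    from covered[OF this] obtain p' q' where "(q', p') \<in> \<sigma>" "p' \<le> B - 1" "B - 1 < q'"
      by blast
    then have pq': "(q', p') \<in> \<sigma>" "p' < B" "B < q'"
      using \<open>A < B\<close> no_path[OF ab(3), of q' p'] by auto
    have "\<alpha> < p'"
      using no_cover[OF pq'(1) ab(3)] no_path[OF pq'(1) ab(3)] ab pq' by auto
    then have c2: "\<exists>p1 p2 p3 p4. p1 < p2 \<and> p2 < p3 \<and> p3 < p4 \<and> (p1, p3) \<in> \<sigma> \<and> (p4, p2) \<in> \<sigma>"
      using pq' ab by blast
    have no_cross: "\<not> ((p1, p3) \<in> \<sigma> \<and> (p2, p4) \<in> \<sigma>)" "\<not> ((p3, p1) \<in> \<sigma> \<and> (p4, p2) \<in> \<sigma>)"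
      if "p1 < p2" "p2 < p3" "p3 < p4" for p1 p2 p3 p4
      using cr c1 c2 that unfolding crossing_restricted_def by blast+
    \<comment> \<open>Unless \<open>\<alpha> = A\<close> or \<open>\<beta> = B\<close>, the arrows
      from \<open>\<alpha>\<close> to \<open>B\<close> and from \<open>A\<close> to
      \<open>\<beta>\<close> are crossing forward arrows.\<close>
    have "(A, B) \<in> \<sigma>"
      using no_cross(1)[of \<alpha> A B \<beta>] le[OF ab(3,4)] le[OF ab(1,2)] ab \<open>A < B\<close>
      by (metis le_neq_implies_less)
    then have "q < B" using below[OF pq] \<open>A < B\<close> by blast
    then obtain p2 q2 where q2: "(q2, p2) \<in> \<sigma>" "p2 \<le> q" "q < q2"
      using covered[of q] pq by auto
    have "p2 \<noteq> A" "p2 \<noteq> q"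
      using no_path[OF q2(1)] ab(1) pq(1) by auto
    \<comment> \<open>By maximality of \<open>q\<close>, the arrow over the gap at \<open>q\<close>
      has its head to the right of \<open>A\<close>, so it crosses the backward arrow with tail
      \<open>q\<close>.\<close>
    moreover have "\<not> p2 < A"
    proof
      assume "p2 < A"
      then have "q2 \<in> Q" using q2 pq by (auto simp: Q_def)
      then show False using finQ q2 by (auto simp: q_def dest: Max_ge)
    qed
    ultimately have "A < p2" "p2 < q" using q2 by auto
    then show ?thesis
      using no_cross(2)[of p p2 q q2] pq q2 by auto
  qed
qed

text \<open>The common part \<open>c\<close> cancels in every prefix difference. What is left at
  \<open>r\<close> is the forward weight minus the backward weight over the gap after
  \<open>r\<close>: at most the total forward weight, and equal to it at a gap supplied by
  \<open>common_forward_gap\<close>.\<close>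

lemma reaches_iff_forward_sum:
  fixes lab :: "arrow \<Rightarrow> nat" and c :: "nat \<Rightarrow> nat"
  assumes sub: "\<sigma> \<subseteq> arrows n" and fin: "finite \<sigma>"
    and alt: "alternating_nonseparated \<sigma>" and cr: "crossing_restricted \<sigma>"
    and ks: "ks = map (\<lambda>l. c l + (\<Sum>a | a \<in> \<sigma> \<and> fst a = l. lab a)) [1..<n+2]"
    and js: "js = map (\<lambda>l. c l + (\<Sum>a | a \<in> \<sigma> \<and> snd a = l. lab a)) [1..<n+2]"
    and d: "d > 0"
  shows "reaches d ks js \<longleftrightarrow> d \<le> (\<Sum>a | a \<in> \<sigma> \<and> forward a. lab a)"
proof -
  have bounds: "1 \<le> fst a" "fst a \<le> n + 1" "1 \<le> snd a" "snd a \<le> n + 1" "fst a \<noteq> snd a"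
    if "a \<in> \<sigma>" for a
    using sub that by (auto simp: arrows_def)
  have prefix: "sum_list (take r (map (\<lambda>l. c l + (\<Sum>a | a \<in> \<sigma> \<and> g a = l. lab a)) [1..<n+2]))
      = (\<Sum>l=1..r. c l) + (\<Sum>a | a \<in> \<sigma> \<and> g a \<le> r. lab a)"
    if r: "r \<le> n + 1" and g: "\<And>a. a \<in> \<sigma> \<Longrightarrow> 1 \<le> g a" for r and g :: "arrow \<Rightarrow> nat"
  proof -
    have "sum_list (take r (map (\<lambda>l. c l + (\<Sum>a | a \<in> \<sigma> \<and> g a = l. lab a)) [1..<n+2])) =
        (\<Sum>l=1..r. c l + (\<Sum>a | a \<in> \<sigma> \<and> g a = l. lab a))"
      using r by (simp add: take_map take_upt sum_list_distinct_conv_sum_set atLeastLessThanSuc_atLeastAtMost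
          del: upt_Suc)
    also have "\<dots> = (\<Sum>l=1..r. c l) + (\<Sum>l=1..r. \<Sum>a | a \<in> \<sigma> \<and> g a = l. lab a)"
      by (rule sum.distrib)
    also have "(\<Sum>l=1..r. \<Sum>a | a \<in> \<sigma> \<and> g a = l. lab a) =
        (\<Sum>l=1..r. \<Sum>a | a \<in> {a \<in> \<sigma>. g a \<le> r} \<and> g a = l. lab a)"
      by (intro sum.cong) auto
    also have "\<dots> = (\<Sum>a | a \<in> \<sigma> \<and> g a \<le> r. lab a)"
      using fin g by (intro sum.group) auto
    finally show ?thesis .
  qed
  have reach: "reaches d ks js \<longleftrightarrow> (\<exists>r\<le>n+1. (\<Sum>a | a \<in> \<sigma> \<and> snd a \<le> r. lab a) + d \<le> (\<Sum>a | a \<in> \<sigma> \<and> fst a \<le> r. lab a))"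
    using prefix[of _ fst] prefix[of _ snd] bounds
    by (auto simp: reaches_def ks js simp del: upt_Suc)
  show ?thesis
  proof
    assume "reaches d ks js"
    then obtain r where r: "(\<Sum>a | a \<in> \<sigma> \<and> snd a \<le> r. lab a) + d \<le> (\<Sum>a | a \<in> \<sigma> \<and> fst a \<le> r. lab a)"
      using reach by blast
    \<comment> \<open>An arrow with tail at most \<open>r\<close> has its head there too, or it is
      forward.\<close>
    have "(\<Sum>a | a \<in> \<sigma> \<and> fst a \<le> r. lab a) \<le>
        (\<Sum>a\<in>{a. a \<in> \<sigma> \<and> snd a \<le> r} \<union> {a. a \<in> \<sigma> \<and> forward a}. lab a)"
      using fin by (intro sum_mono2) (auto simp: forward_def)
    also have "\<dots> \<le> (\<Sum>a | a \<in> \<sigma> \<and> snd a \<le> r. lab a) + (\<Sum>a | a \<in> \<sigma> \<and> forward a. lab a)"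
      using fin by (subst sum.union_inter[symmetric]) auto
    finally show "d \<le> (\<Sum>a | a \<in> \<sigma> \<and> forward a. lab a)" using r by linarith
  next
    assume le: "d \<le> (\<Sum>a | a \<in> \<sigma> \<and> forward a. lab a)"
    then have "{a. a \<in> \<sigma> \<and> forward a} \<noteq> {}" using d by (metis not_le sum.empty)
    then obtain p0 q0 where pq0: "(p0, q0) \<in> \<sigma>" "p0 < q0" by (auto simp: forward_def)
    from common_forward_gap[OF fin alt cr pq0] obtain k where
      k: "\<And>p q. (p, q) \<in> \<sigma> \<Longrightarrow> p < q \<Longrightarrow> p \<le> k \<and> k < q"
         "\<And>p q. (p, q) \<in> \<sigma> \<Longrightarrow> q \<le> k \<Longrightarrow> p \<le> k" by metis
    have "(\<Sum>a | a \<in> \<sigma> \<and> snd a \<le> k. lab a) + (\<Sum>a | a \<in> \<sigma> \<and> forward a. lab a) =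
        (\<Sum>a\<in>{a. a \<in> \<sigma> \<and> snd a \<le> k} \<union> {a. a \<in> \<sigma> \<and> forward a}. lab a)"
      using fin k(1) by (intro sum.union_disjoint[symmetric]) (force simp: forward_def)+
    also have "\<dots> \<le> (\<Sum>a | a \<in> \<sigma> \<and> fst a \<le> k. lab a)"
      using fin k by (intro sum_mono2) (auto simp: forward_def)
    finally have "(\<Sum>a | a \<in> \<sigma> \<and> snd a \<le> k. lab a) + d \<le> (\<Sum>a | a \<in> \<sigma> \<and> fst a \<le> k. lab a)"
      using le by linarith
    moreover have "k \<le> n + 1" using k(1)[OF pq0] bounds[OF pq0(1)] by auto
    ultimately show "reaches d ks js" using reach by blast
  qed
qed

section \<open>Labelled faces and pairs of weak compositions\<close>

text \<open>Compositions indexed by a set \<open>S\<close>, with the parts in \<open>P\<close>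
  strict. Extensionality outside \<open>S\<close> makes the functions countable as such.\<close>

definition pos_functions :: "'a set \<Rightarrow> 'a set \<Rightarrow> nat \<Rightarrow> ('a \<Rightarrow> nat) set" where
  "pos_functions S P s = {g \<in> S \<rightarrow>\<^sub>E UNIV. (\<forall>a\<in>P. g a > 0) \<and> sum g S = s}"

lemma bij_betw_pos_functions_weak_comps:
  assumes "finite S"
  shows "\<exists>f. bij_betw f (pos_functions S {} s) (weak_comps (card S) s)"
proof -
  obtain h where h: "bij_betw h {0..<card S} S"
    using assms ex_bij_betw_nat_finite by blast
  have sums: "sum_list (map (g \<circ> h) [0..<card S]) = sum g S" for g :: "_ \<Rightarrow> nat"
    using sum.reindex_bij_betw[OF h, of g] by (simp add: sum_list_distinct_conv_sum_set)
  have "bij_betw (\<lambda>g. map (g \<circ> h) [0..<card S]) (pos_functions S {} s) (weak_comps (card S) s)"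
  proof (rule bij_betwI')
    fix f g assume "f \<in> pos_functions S {} s" "g \<in> pos_functions S {} s"
    then have ext: "f \<in> extensional S" "g \<in> extensional S"
      by (auto simp: pos_functions_def PiE_def)
    show "map (f \<circ> h) [0..<card S] = map (g \<circ> h) [0..<card S] \<longleftrightarrow> f = g"
    proof
      assume eq: "map (f \<circ> h) [0..<card S] = map (g \<circ> h) [0..<card S]"
      show "f = g"
      proof (rule extensionalityI[OF ext])
        fix x assume "x \<in> S"
        then have "x \<in> h ` {0..<card S}" using h by (simp add: bij_betw_def)
        then obtain i where "i < card S" "x = h i" by auto
        with eq show "f x = g x" by (simp add: map_eq_conv)
      qed
    qed simp
  next
    fix f assume "f \<in> pos_functions S {} s"
    then show "map (f \<circ> h) [0..<card S] \<in> weak_comps (card S) s"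
      using sums[of f] by (simp add: pos_functions_def weak_comps_def)
  next
    fix ks assume ks: "ks \<in> weak_comps (card S) s"
    define g where "g = restrict (\<lambda>x. ks ! the_inv_into {0..<card S} h x) S"
    have "map (g \<circ> h) [0..<card S] = ks"
      using h ks by (intro nth_equalityI)
        (auto simp: g_def weak_comps_def bij_betw_def the_inv_into_f_f)
    moreover from this have "g \<in> pos_functions S {} s"
      using sums[of g] ks by (auto simp: pos_functions_def weak_comps_def g_def)
    ultimately show "\<exists>f\<in>pos_functions S {} s. ks = map (f \<circ> h) [0..<card S]" by blast
  qed
  then show ?thesis by blast
qed

lemma card_pos_functions_unrestricted:
  assumes "finite S" "S \<noteq> {}"
  shows "card (pos_functions S {} s) = (s + (card S - 1)) choose (card S - 1)"
proof -
  obtain m where m: "card S = Suc m" using assms by (metis card_0_eq not0_implies_Suc)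
  then show ?thesis
    using bij_betw_pos_functions_weak_comps[OF assms(1), of s] card_weak_comps[of m s]
    by (auto dest: bij_betw_same_card)
qed

text \<open>Subtracting 1 on \<open>P\<close> leaves a weak composition. The hypothesis
  \<open>edge\<close> excludes \<open>s = 0\<close> with \<open>P = S\<close>: for a one-element
  \<open>S\<close>, truncated subtraction would then give the value 1 for an empty set of
  functions.\<close>

lemma card_pos_functions:
  assumes fin: "finite S" "S \<noteq> {}" and P: "P \<subseteq> S" and edge: "s > 0 \<or> P \<noteq> S"
  shows "card (pos_functions S P s) = (s + card S - card P - 1) choose (card S - 1)"
proof -
  have finP: "finite P" and cP: "card P \<le> card S"
    using fin P by (auto intro: finite_subset card_mono)
  have cS: "card S > 0" using fin by (simp add: card_gt_0_iff)
  have shift: "sum g S = sum (\<lambda>a. if a \<in> P then g a - 1 else g a) S + card P"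
    if "\<forall>a\<in>P. g a > 0" for g :: "'a \<Rightarrow> nat"
  proof -
    have "sum g S = (\<Sum>a\<in>S. (if a \<in> P then g a - 1 else g a) + (if a \<in> P then 1 else 0))"
      using that by (intro sum.cong) auto
    also have "\<dots> = sum (\<lambda>a. if a \<in> P then g a - 1 else g a) S + (\<Sum>a\<in>S. if a \<in> P then 1 else 0)"
      by (rule sum.distrib)
    also have "(\<Sum>a\<in>S. if a \<in> P then 1 else 0) = card P"
      using fin P by (simp add: Int_absorb1 flip: sum.inter_restrict)
    finally show ?thesis .
  qed
  show ?thesis
  proof (cases "card P \<le> s")
    case False
    then have "pos_functions S P s = {}"
      using shift by (force simp: pos_functions_def)
    moreover have "s + card S - card P - 1 < card S - 1"
    proof (cases "card P < card S")
      case False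
      then have "P = S" using P cP fin card_subset_eq[of S P] by auto
      then show ?thesis using edge \<open>\<not> card P \<le> s\<close> by auto
    qed (use \<open>\<not> card P \<le> s\<close> in auto)
    ultimately show ?thesis by (simp add: binomial_eq_0)
  next
    case True
    have "bij_betw (\<lambda>g a. if a \<in> P then g a + 1 else g a) (pos_functions S {} (s - card P))
        (pos_functions S P s)"
    proof (rule bij_betw_byWitness[where f' = "\<lambda>g a. if a \<in> P then g a - 1 else g a"])
      show "(\<lambda>g a. if a \<in> P then g a + 1 else g a) ` pos_functions S {} (s - card P)
          \<subseteq> pos_functions S P s"
      proof safe
        fix g assume g: "g \<in> pos_functions S {} (s - card P)"
        have "sum (\<lambda>a. if a \<in> P then g a + 1 else g a) S = sum g S + card P"
          using shift[of "\<lambda>a. if a \<in> P then g a + 1 else g a"]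
          by (simp add: if_distrib cong: if_cong sum.cong)
        then show "(\<lambda>a. if a \<in> P then g a + 1 else g a) \<in> pos_functions S P s"
          using g True P by (auto simp: pos_functions_def PiE_def extensional_def)
      qed
      show "(\<lambda>g a. if a \<in> P then g a - 1 else g a) ` pos_functions S P s
          \<subseteq> pos_functions S {} (s - card P)"
      proof safe
        fix g assume g: "g \<in> pos_functions S P s"
        then show "(\<lambda>a. if a \<in> P then g a - 1 else g a) \<in> pos_functions S {} (s - card P)"
          using shift[of g] P by (auto simp: pos_functions_def PiE_def extensional_def)
      qed
    qed (auto simp: pos_functions_def fun_eq_iff)
    then have "card (pos_functions S P s) = card (pos_functions S {} (s - card P))"
      by (simp add: bij_betw_same_card)
    also have "\<dots> = (s + card S - card P - 1) choose (card S - 1)"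
      using True cS by (subst card_pos_functions_unrestricted[OF fin]) (auto intro!: arg_cong2[of _ _ _ _ "(choose)"])
    finally show ?thesis .
  qed
qed

lemma finite_pos_functions:
  assumes "finite S"
  shows "finite (pos_functions S P s)"
proof (rule finite_subset)
  show "pos_functions S P s \<subseteq> S \<rightarrow>\<^sub>E {..s}"
    using assms by (auto simp: pos_functions_def PiE_def extensional_def intro!: member_le_sum)
  show "finite (S \<rightarrow>\<^sub>E {..s})" using assms by (simp add: finite_PiE)
qed

text \<open>The largest prefix excess is exactly \<open>a\<close>. Quantifying over
  \<open>d > 0\<close> expresses this without a maximum and includes \<open>a = 0\<close>, where no
  positive height is reached.\<close>

definition peak_pairs :: "nat \<Rightarrow> nat \<Rightarrow> nat \<Rightarrow> (nat list \<times> nat list) set" where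
  "peak_pairs n a m = {(ks, js). ks \<in> weak_comps (Suc n) m \<and> js \<in> weak_comps (Suc n) m \<and>
     (\<forall>d>0. reaches d ks js \<longleftrightarrow> d \<le> a)}"

lemma card_peak_pairs_0:
  assumes "n \<ge> 1"
  shows "card (peak_pairs n 0 M) + ((M + n) choose Suc n) * ((M + n) choose (n - 1))
    = ((M + n) choose n)\<^sup>2"
proof -
  have mono: "reaches 1 ks js" if "reaches d ks js" "d > 0" for d ks js
    using reaches_mono[OF that(1), of 1] that(2) by simp
  have "weak_comps (Suc n) M \<times> weak_comps (Suc n) M =
      peak_pairs n 0 M \<union> reaching_pairs (Suc n) 1 M M"
    using mono by (auto simp: peak_pairs_def reaching_pairs_def)
  moreover have "peak_pairs n 0 M \<inter> reaching_pairs (Suc n) 1 M M = {}"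
    by (auto simp: peak_pairs_def reaching_pairs_def)
  moreover have "finite (peak_pairs n 0 M)"
    by (rule finite_subset[of _ "weak_comps (Suc n) M \<times> weak_comps (Suc n) M"])
      (auto simp: peak_pairs_def)
  ultimately have "card (peak_pairs n 0 M) + card (reaching_pairs (Suc n) 1 M M) =
      ((M + n) choose n)\<^sup>2"
    by (metis card_Un_disjoint card_cartesian_product card_weak_comps finite_reaching_pairs power2_eq_square)
  moreover have "card (reaching_pairs (Suc n) 1 M M) = ((M + n) choose Suc n) * ((M + n) choose (n - 1))"
    using assms by (subst card_reaching_pairs) auto
  ultimately show ?thesis by simp
qed

text \<open>Pairs reaching \<open>a\<close> split into those with peak \<open>a\<close> and those
  reaching \<open>a + 1\<close>. Both counts are ballot products with \<open>x = y = M + a\<close>,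
  which is where the index \<open>M + 2 * a\<close> comes from.\<close>

lemma card_peak_pairs:
  assumes "n \<ge> 1" "a \<ge> 1"
  shows "card (peak_pairs n a (M + a)) + ((M + n) choose Suc n) * ((M + 2 * a + n) choose (n - 1))
    = ((M + Suc n) choose Suc n) * ((M + 2 * a + n - 1) choose (n - 1))"
proof -
  have "reaching_pairs (Suc n) a (M + a) (M + a) =
      peak_pairs n a (M + a) \<union> reaching_pairs (Suc n) (a + 1) (M + a) (M + a)"
  proof (intro equalityI subsetI)
    fix p assume p: "p \<in> reaching_pairs (Suc n) a (M + a) (M + a)"
    show "p \<in> peak_pairs n a (M + a) \<union> reaching_pairs (Suc n) (a + 1) (M + a) (M + a)"
    proof (cases "reaches (a + 1) (fst p) (snd p)")
      case True
      with p show ?thesis by (auto simp: reaching_pairs_def)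
    next
      case False
      have "reaches a (fst p) (snd p)" using p by (auto simp: reaching_pairs_def)
      have "reaches d (fst p) (snd p) \<longleftrightarrow> d \<le> a" for d
      proof
        assume d: "reaches d (fst p) (snd p)"
        show "d \<le> a"
        proof (rule ccontr)
          assume "\<not> d \<le> a"
          then have "a + 1 \<le> d" by simp
          with d False show False using reaches_mono by blast
        qed
      qed (use \<open>reaches a (fst p) (snd p)\<close> in \<open>rule reaches_mono\<close>)
      then have "p \<in> peak_pairs n a (M + a)"
        using p by (simp add: reaching_pairs_def peak_pairs_def case_prod_beta)
      then show ?thesis by blast
    qed
  next
    fix p assume p: "p \<in> peak_pairs n a (M + a) \<union> reaching_pairs (Suc n) (a + 1) (M + a) (M + a)"
    obtain ks js where kj: "p = (ks, js)" by (cases p)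
    have "reaches a ks js"
    proof (cases "p \<in> peak_pairs n a (M + a)")
      case True
      then have "\<forall>d>0. reaches d ks js \<longleftrightarrow> d \<le> a" by (simp add: peak_pairs_def kj)
      with assms(2) show ?thesis by simp
    next
      case False
      with p have "reaches (a + 1) ks js" by (simp add: reaching_pairs_def kj)
      then show ?thesis by (rule reaches_mono) simp
    qed
    moreover have "ks \<in> weak_comps (Suc n) (M + a)" "js \<in> weak_comps (Suc n) (M + a)"
      using p by (auto simp: reaching_pairs_def peak_pairs_def kj)
    ultimately show "p \<in> reaching_pairs (Suc n) a (M + a) (M + a)"
      by (simp add: reaching_pairs_def kj)
  qed
  moreover have "peak_pairs n a (M + a) \<inter> reaching_pairs (Suc n) (a + 1) (M + a) (M + a) = {}"
    by (auto simp: peak_pairs_def reaching_pairs_def)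
  moreover have "finite (peak_pairs n a (M + a))"
    by (rule finite_subset[of _ "weak_comps (Suc n) (M + a) \<times> weak_comps (Suc n) (M + a)"])
      (auto simp: peak_pairs_def)
  ultimately have "card (peak_pairs n a (M + a)) + card (reaching_pairs (Suc n) (a + 1) (M + a) (M + a)) =
      card (reaching_pairs (Suc n) a (M + a) (M + a))"
    by (metis card_Un_disjoint finite_reaching_pairs)
  moreover have "card (reaching_pairs (Suc n) (a + 1) (M + a) (M + a)) =
      ((M + n) choose Suc n) * ((M + 2 * a + n) choose (n - 1))"
    using assms by (subst card_reaching_pairs) (auto simp: mult_2 add_ac)
  moreover have "card (reaching_pairs (Suc n) a (M + a) (M + a)) =
      ((M + Suc n) choose Suc n) * ((M + 2 * a + n - 1) choose (n - 1))"
    using assms by (subst card_reaching_pairs) (auto simp: mult_2 add_ac)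
  ultimately show ?thesis by simp
qed

text \<open>The \<open>Inr\<close> values at the vertices are to be the pointwise minimum of a pair
  of compositions. They share the total \<open>M\<close> with the backward weights, because only the
  forward weight and the total of the pair are prescribed.\<close>

definition face_labellings :: "nat \<Rightarrow> nat \<Rightarrow> nat \<Rightarrow> arrow set \<Rightarrow> ((arrow \<Rightarrow> nat) \<times> (arrow + nat \<Rightarrow> nat)) set" where
  "face_labellings n a M \<sigma> = pos_functions {x\<in>\<sigma>. forward x} {x\<in>\<sigma>. forward x} a \<times>
     pos_functions ({x\<in>\<sigma>. backward x} <+> {1..n+1}) (Inl ` {x\<in>\<sigma>. backward x}) M"

lemma card_face_labellings:
  assumes "finite \<sigma>"
  shows "card (face_labellings n a M \<sigma>) =
    (if card {x\<in>\<sigma>. forward x} = 0 then (if a = 0 then 1 else 0)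
     else if a = 0 then 0 else (a - 1) choose (card {x\<in>\<sigma>. forward x} - 1)) *
    ((M + n) choose (n + card {x\<in>\<sigma>. backward x}))"
proof -
  let ?F = "{x\<in>\<sigma>. forward x}" and ?B = "{x\<in>\<sigma>. backward x}"
  have fin: "finite ?F" "finite ?B" using assms by auto
  have "card (pos_functions ?F ?F a) = (if card ?F = 0 then (if a = 0 then 1 else 0)
     else if a = 0 then 0 else (a - 1) choose (card ?F - 1))"
  proof (cases "?F = {}")
    case True
    then show ?thesis unfolding True by (auto simp: pos_functions_def)
  next
    case False
    show ?thesis
    proof (cases "a = 0")
      case True
      have "pos_functions ?F ?F a = {}"
        using False fin unfolding pos_functions_def True by fastforce
      then show ?thesis using False fin True by simp
    next
      case a: False
      show ?thesis
        using False fin a by (subst card_pos_functions) auto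
    qed
  qed
  moreover have "card (pos_functions (?B <+> {1..n+1}) (Inl ` ?B) M) = (M + n) choose (n + card ?B)"
  proof -
    have "Inr 1 \<in> ?B <+> {1..n+1}" by auto
    then have "Inl ` ?B \<noteq> ?B <+> {1..n+1}" "?B <+> {1..n+1} \<noteq> {}" by blast+
    moreover have "card (Inl ` ?B :: (arrow + nat) set) = card ?B" by (simp add: card_image)
    ultimately show ?thesis
      using fin by (subst card_pos_functions) (auto simp: card_Plus add_ac)
  qed
  ultimately show ?thesis by (simp add: face_labellings_def card_cartesian_product)
qed

text \<open>A pair of weak compositions splits into its pointwise minimum and a difference; the latter is
  a net flow, hence a unique positive combination of the arrows of one face.\<close>

lemma card_peak_pairs_faces:
  assumes fin: "finite \<Delta>"
    and faces: "\<And>\<sigma>. \<sigma> \<in> \<Delta> \<Longrightarrow> \<sigma> \<subseteq> arrows n \<and> finite \<sigma> \<and> alternating_nonseparated \<sigma> \<and> crossing_restricted \<sigma>"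
    and ex: "\<And>x :: nat \<Rightarrow> int. (\<Sum>l=1..n+1. x l) = 0 \<Longrightarrow> \<exists>\<sigma>\<in>\<Delta>. \<exists>lab :: arrow \<Rightarrow> nat.
      (\<forall>a\<in>\<sigma>. lab a > 0) \<and> (\<forall>l\<in>{1..n+1}. net_flow \<sigma> (int \<circ> lab) l = x l)"
    and uniq: "\<And>\<sigma> \<tau> (lab :: arrow \<Rightarrow> nat) lab'. \<sigma> \<in> \<Delta> \<Longrightarrow> \<tau> \<in> \<Delta> \<Longrightarrow> (\<forall>a\<in>\<sigma>. lab a > 0) \<Longrightarrow>
      (\<forall>a\<in>\<tau>. lab' a > 0) \<Longrightarrow>
      (\<forall>l\<in>{1..n+1}. net_flow \<sigma> (int \<circ> lab) l = net_flow \<tau> (int \<circ> lab') l) \<Longrightarrow>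
      \<sigma> = \<tau> \<and> (\<forall>a\<in>\<sigma>. lab a = lab' a)"
  shows "card (peak_pairs n a (M + a)) = (\<Sum>\<sigma>\<in>\<Delta>. card (face_labellings n a M \<sigma>))"
proof -
  define lab :: "(arrow \<Rightarrow> nat) \<Rightarrow> (arrow + nat \<Rightarrow> nat) \<Rightarrow> arrow \<Rightarrow> nat"
    where "lab f g x = (if forward x then f x else g (Inl x))" for f g x
  define mult :: "(arrow \<Rightarrow> nat) \<Rightarrow> arrow set \<Rightarrow> (arrow \<Rightarrow> nat) \<Rightarrow> (arrow + nat \<Rightarrow> nat) \<Rightarrow> nat \<Rightarrow> nat"
    where "mult e \<sigma> f g l = g (Inr l) + (\<Sum>x | x \<in> \<sigma> \<and> e x = l. lab f g x)" for e \<sigma> f g l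
  define \<Psi> where "\<Psi> = (\<lambda>(\<sigma>, f, g). (map (mult fst \<sigma> f g) [1..<n+2], map (mult snd \<sigma> f g) [1..<n+2]))"
  have fb: "\<sigma> = {x\<in>\<sigma>. forward x} \<union> {x\<in>\<sigma>. backward x}" "{x\<in>\<sigma>. forward x} \<inter> {x\<in>\<sigma>. backward x} = {}"
    if "\<sigma> \<in> \<Delta>" for \<sigma>
    using faces[OF that] by (auto simp: arrows_def forward_def backward_def)
  have bwd: "backward x" if "\<sigma> \<in> \<Delta>" "x \<in> \<sigma>" "\<not> forward x" for x \<sigma>
    using faces[OF that(1)] that(2,3) by (auto simp: arrows_def forward_def backward_def)
  \<comment> \<open>At a vertex of an alternating face all arrows start or all arrows end. Hence one
    of the two arrow sums vanishes, and the \<open>Inr\<close> label is really the minimum of the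
    two entries.\<close>
  have one_side: "(\<Sum>x | x \<in> \<sigma> \<and> fst x = l. h x) = 0 \<or> (\<Sum>x | x \<in> \<sigma> \<and> snd x = l. h x) = 0"
    if "\<sigma> \<in> \<Delta>" for \<sigma> l and h :: "arrow \<Rightarrow> nat"
  proof -
    have "{x. x \<in> \<sigma> \<and> fst x = l} = {} \<or> {x. x \<in> \<sigma> \<and> snd x = l} = {}"
      using faces[OF that] by (fastforce simp: alternating_nonseparated_def)
    then show ?thesis by (elim disjE) (simp_all only: sum.empty simp_thms)
  qed
  have reach: "reaches d (fst (\<Psi> (\<sigma>, f, g))) (snd (\<Psi> (\<sigma>, f, g))) \<longleftrightarrow>
      d \<le> (\<Sum>x | x \<in> \<sigma> \<and> forward x. lab f g x)" if "\<sigma> \<in> \<Delta>" "d > 0" for d \<sigma> f g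
  proof -
    have "fst (\<Psi> (\<sigma>, f, g)) = map (\<lambda>l. g (Inr l) + (\<Sum>x | x \<in> \<sigma> \<and> fst x = l. lab f g x)) [1..<n+2]"
      "snd (\<Psi> (\<sigma>, f, g)) = map (\<lambda>l. g (Inr l) + (\<Sum>x | x \<in> \<sigma> \<and> snd x = l. lab f g x)) [1..<n+2]"
      unfolding \<Psi>_def prod.case fst_conv snd_conv by (intro map_cong refl mult_def)+
    with faces[OF that(1)] that(2) show ?thesis
      by (intro reaches_iff_forward_sum) auto
  qed
  have total: "sum_list (map (mult e \<sigma> f g) [1..<n+2]) =
      (\<Sum>l=1..n+1. g (Inr l)) + (\<Sum>x\<in>\<sigma>. lab f g x)"
    if "\<sigma> \<in> \<Delta>" and e: "e = fst \<or> e = snd" for e \<sigma> f g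
  proof -
    have "e ` \<sigma> \<subseteq> {1..n+1}" using faces[OF that(1)] e by (auto simp: arrows_def)
    then have "(\<Sum>l=1..n+1. \<Sum>x | x \<in> \<sigma> \<and> e x = l. lab f g x) = (\<Sum>x\<in>\<sigma>. lab f g x)"
      using faces[OF that(1)] by (intro sum.group) auto
    then show ?thesis
      by (simp add: sum_list_distinct_conv_sum_set mult_def sum.distrib atLeastLessThanSuc_atLeastAtMost
          del: upt_Suc)
  qed
  have weights: "(\<Sum>x\<in>\<sigma>. lab f g x) = (\<Sum>x | x \<in> \<sigma> \<and> forward x. f x) + (\<Sum>x | x \<in> \<sigma> \<and> backward x. g (Inl x))"
    if "\<sigma> \<in> \<Delta>" for \<sigma> f g
  proof -
    have "(\<Sum>x\<in>\<sigma>. lab f g x) = (\<Sum>x | x \<in> \<sigma> \<and> forward x. lab f g x) + (\<Sum>x | x \<in> \<sigma> \<and> backward x. lab f g x)"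
      using faces[OF that] fb(2)[OF that] by (subst fb(1)[OF that], subst sum.union_disjoint) auto
    also have "\<dots> = (\<Sum>x | x \<in> \<sigma> \<and> forward x. f x) + (\<Sum>x | x \<in> \<sigma> \<and> backward x. g (Inl x))"
      by (intro arg_cong2[of _ _ _ _ "(+)"] sum.cong) (auto simp: lab_def forward_def backward_def)
    finally show ?thesis .
  qed
  have sumPlus: "sum g ({x\<in>\<sigma>. backward x} <+> {1..n+1}) =
      (\<Sum>x | x \<in> \<sigma> \<and> backward x. g (Inl x)) + (\<Sum>l=1..n+1. g (Inr l))"
    if "\<sigma> \<in> \<Delta>" for \<sigma> and g :: "arrow + nat \<Rightarrow> nat"
    using faces[OF that] by (subst sum.Plus) (auto simp: comp_def)
  have nth: "map (mult e \<sigma> f g) [1..<n+2] ! (l - 1) = mult e \<sigma> f g l" if "l \<in> {1..n+1}" for e \<sigma> f g l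
    using that by (subst nth_map) (auto simp del: upt_Suc)
  have "bij_betw \<Psi> (Sigma \<Delta> (face_labellings n a M)) (peak_pairs n a (M + a))"
  proof (rule bij_betw_imageI)
    show "inj_on \<Psi> (Sigma \<Delta> (face_labellings n a M))"
    proof (rule inj_onI)
      fix u v assume u: "u \<in> Sigma \<Delta> (face_labellings n a M)"
        and v: "v \<in> Sigma \<Delta> (face_labellings n a M)" and eq: "\<Psi> u = \<Psi> v"
      obtain \<sigma> f g \<tau> f' g' where uv: "u = (\<sigma>, f, g)" "v = (\<tau>, f', g')" by (metis prod.exhaust)
      have \<sigma>: "\<sigma> \<in> \<Delta>" "(f, g) \<in> face_labellings n a M \<sigma>"
        and \<tau>: "\<tau> \<in> \<Delta>" "(f', g') \<in> face_labellings n a M \<tau>"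
        using u v uv by auto
      have "map (mult fst \<sigma> f g) [1..<n+2] = map (mult fst \<tau> f' g') [1..<n+2]"
        "map (mult snd \<sigma> f g) [1..<n+2] = map (mult snd \<tau> f' g') [1..<n+2]"
        using eq by (simp_all only: uv \<Psi>_def prod.case prod.inject)
      then have m: "mult fst \<sigma> f g l = mult fst \<tau> f' g' l" "mult snd \<sigma> f g l = mult snd \<tau> f' g' l"
        if "l \<in> {1..n+1}" for l
        using that by (auto simp: map_eq_conv simp del: upt_Suc)
      \<comment> \<open>The \<open>Inr\<close> labels cancel in the difference of the two entries,
        so equal pairs have equal flows.\<close>
      have "net_flow \<sigma> (int \<circ> lab f g) l = net_flow \<tau> (int \<circ> lab f' g') l" if "l \<in> {1..n+1}" for l
        using m[OF that] by (simp add: net_flow_def mult_def flip: of_nat_sum)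
      moreover have "\<forall>x\<in>\<sigma>. lab f g x > 0" "\<forall>x\<in>\<tau>. lab f' g' x > 0"
        using \<sigma> \<tau> bwd[OF \<sigma>(1)] bwd[OF \<tau>(1)]
        by (auto simp: face_labellings_def pos_functions_def lab_def)
      ultimately have same: "\<sigma> = \<tau>" "\<forall>x\<in>\<sigma>. lab f g x = lab f' g' x"
        using uniq[OF \<sigma>(1) \<tau>(1)] by blast+
      have "f = f'"
      proof (rule extensionalityI)
        show "f \<in> extensional {x\<in>\<sigma>. forward x}" "f' \<in> extensional {x\<in>\<sigma>. forward x}"
          using \<sigma> \<tau> same(1) by (auto simp: face_labellings_def pos_functions_def PiE_def)
        show "f x = f' x" if "x \<in> {x\<in>\<sigma>. forward x}" for x
          using same(2) that by (force simp: lab_def)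
      qed
      moreover have "g = g'"
      proof (rule extensionalityI)
        show "g \<in> extensional ({x\<in>\<sigma>. backward x} <+> {1..n+1})"
          "g' \<in> extensional ({x\<in>\<sigma>. backward x} <+> {1..n+1})"
          using \<sigma> \<tau> same(1) by (auto simp: face_labellings_def pos_functions_def PiE_def)
        show "g z = g' z" if z: "z \<in> {x\<in>\<sigma>. backward x} <+> {1..n+1}" for z
        proof (cases z)
          case (Inl x)
          with z same(2) show ?thesis by (force simp: lab_def forward_def backward_def)
        next
          case (Inr l)
          have "(\<Sum>x | x \<in> \<sigma> \<and> fst x = l. lab f g x) = (\<Sum>x | x \<in> \<sigma> \<and> fst x = l. lab f' g' x)"
            using same(2) by (intro sum.cong) auto
          with m(1)[of l] z Inr same(1) show ?thesis by (auto simp: mult_def)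
        qed
      qed
      ultimately show "u = v" using uv same by simp
    qed
    show "\<Psi> ` Sigma \<Delta> (face_labellings n a M) = peak_pairs n a (M + a)"
    proof (intro equalityI subsetI)
      fix p assume "p \<in> \<Psi> ` Sigma \<Delta> (face_labellings n a M)"
      then obtain \<sigma> f g where p: "p = \<Psi> (\<sigma>, f, g)" and \<sigma>: "\<sigma> \<in> \<Delta>"
        and fg: "(f, g) \<in> face_labellings n a M \<sigma>" by auto
      have "(\<Sum>x | x \<in> \<sigma> \<and> forward x. f x) = a"
        using fg by (simp add: face_labellings_def pos_functions_def)
      moreover from this have "(\<Sum>x | x \<in> \<sigma> \<and> forward x. lab f g x) = a"
        by (simp add: lab_def)
      moreover have "sum g ({x\<in>\<sigma>. backward x} <+> {1..n+1}) = M"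
        using fg by (simp add: face_labellings_def pos_functions_def)
      ultimately show "p \<in> peak_pairs n a (M + a)"
        using reach[OF \<sigma>, of _ f g] total[OF \<sigma>, of fst f g] total[OF \<sigma>, of snd f g] weights[OF \<sigma>, of f g]
          sumPlus[OF \<sigma>, of g]
        by (auto simp: p peak_pairs_def weak_comps_def \<Psi>_def simp del: upt_Suc)
    next
      fix p assume "p \<in> peak_pairs n a (M + a)"
      then obtain ks js where p: "p = (ks, js)" and len: "length ks = Suc n" "length js = Suc n"
        and sums: "sum_list ks = M + a" "sum_list js = M + a"
        and peak: "\<And>d. d > 0 \<Longrightarrow> reaches d ks js \<longleftrightarrow> d \<le> a"
        by (auto simp: peak_pairs_def weak_comps_def)
      define x where "x l = int (ks ! (l - 1)) - int (js ! (l - 1))" for l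
      have shift: "(\<Sum>l=1..n+1. int (us ! (l - 1))) = int (sum_list us)" if "length us = Suc n" for us :: "nat list"
      proof -
        have "(\<Sum>l=1..n+1. int (us ! (l - 1))) = (\<Sum>l=0..<Suc n. int (us ! l))"
          by (rule sum.reindex_bij_witness[of _ Suc "\<lambda>l. l - 1"]) auto
        then show ?thesis using that by (simp only: sum_list_sum_nth of_nat_sum)
      qed
      have "(\<Sum>l=1..n+1. x l) = 0"
        using shift[OF len(1)] shift[OF len(2)] sums by (simp only: x_def sum_subtractf)
      then obtain \<sigma> h where \<sigma>: "\<sigma> \<in> \<Delta>" and h: "\<forall>y\<in>\<sigma>. h y > (0::nat)"
        and flow: "\<forall>l\<in>{1..n+1}. net_flow \<sigma> (int \<circ> h) l = x l"
        using ex by blast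
      define f where "f = restrict h {y\<in>\<sigma>. forward y}"
      define g where "g = restrict (case_sum h (\<lambda>l. min (ks ! (l - 1)) (js ! (l - 1))))
        ({y\<in>\<sigma>. backward y} <+> {1..n+1})"
      have lab: "lab f g y = h y" if "y \<in> \<sigma>" for y
        using that bwd[OF \<sigma>] by (auto simp: lab_def f_def g_def InlI)
      have mults: "mult fst \<sigma> f g l = ks ! (l - 1) \<and> mult snd \<sigma> f g l = js ! (l - 1)"
        if l: "l \<in> {1..n+1}" for l
      proof -
        have gl: "g (Inr l) = min (ks ! (l - 1)) (js ! (l - 1))"
          using l unfolding g_def by (subst restrict_apply') (auto intro: InrI)
        have s: "(\<Sum>y | y \<in> \<sigma> \<and> e y = l. lab f g y) = (\<Sum>y | y \<in> \<sigma> \<and> e y = l. h y)" for e :: "arrow \<Rightarrow> nat"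
          using lab by (intro sum.cong) auto
        have "int (\<Sum>y | y \<in> \<sigma> \<and> fst y = l. h y) - int (\<Sum>y | y \<in> \<sigma> \<and> snd y = l. h y) =
            int (ks ! (l - 1)) - int (js ! (l - 1))"
          using flow l by (simp add: net_flow_def x_def)
        then show ?thesis
          using one_side[OF \<sigma>, where l = l and h = h] unfolding mult_def gl s by linarith
      qed
      have \<Psi>: "\<Psi> (\<sigma>, f, g) = (ks, js)"
        using mults len nth by (auto simp: \<Psi>_def intro!: nth_equalityI simp del: upt_Suc)
      have "(\<Sum>y | y \<in> \<sigma> \<and> forward y. lab f g y) = a"
      proof (rule ccontr)
        define s where "s = (\<Sum>y | y \<in> \<sigma> \<and> forward y. lab f g y)"
        assume "(\<Sum>y | y \<in> \<sigma> \<and> forward y. lab f g y) \<noteq> a"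
        then have "s \<noteq> a" by (simp add: s_def)
        \<comment> \<open>Two naturals with the same positive lower bounds are equal; the bounds
          \<open>s\<close> and \<open>a\<close> themselves suffice as tests.\<close>
        moreover have "d \<le> s \<longleftrightarrow> d \<le> a" if "d > 0" for d
          using peak[OF that] reach[OF \<sigma> that, of f g] \<Psi> by (simp add: s_def)
        from this[of s] this[of a] have "s = a" by linarith
        ultimately show False by simp
      qed
      then have fa: "(\<Sum>y | y \<in> \<sigma> \<and> forward y. f y) = a" by (simp add: lab_def)
      moreover have "(\<Sum>l=1..n+1. g (Inr l)) + (\<Sum>y\<in>\<sigma>. lab f g y) = M + a"
        using total[OF \<sigma>, of fst f g] \<Psi> sums by (simp add: \<Psi>_def del: upt_Suc)
      ultimately have gM: "sum g ({y\<in>\<sigma>. backward y} <+> {1..n+1}) = M"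
        using weights[OF \<sigma>, of f g] sumPlus[OF \<sigma>, of g] by simp
      have "(f, g) \<in> face_labellings n a M \<sigma>"
        using fa gM h by (auto simp: face_labellings_def pos_functions_def f_def g_def)
      then show "p \<in> \<Psi> ` Sigma \<Delta> (face_labellings n a M)"
        using \<sigma> \<Psi> p by force
    qed
  qed
  then have "card (peak_pairs n a (M + a)) = card (Sigma \<Delta> (face_labellings n a M))"
    by (simp add: bij_betw_same_card)
  also have "\<dots> = (\<Sum>\<sigma>\<in>\<Delta>. card (face_labellings n a M \<sigma>))"
  proof (rule card_SigmaI[OF fin], rule ballI)
    fix \<sigma> assume "\<sigma> \<in> \<Delta>"
    then have "finite \<sigma>" using faces by blast
    then show "finite (face_labellings n a M \<sigma>)"
      by (auto simp: face_labellings_def intro!: finite_cartesian_product finite_pos_functions)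
  qed
  finally show ?thesis .
qed

section \<open>Leading coefficients\<close>

lemma tendsto_choose_scaled:
  fixes g :: "nat \<Rightarrow> nat"
  assumes "(\<lambda>N. real (g N) / real N) \<longlonglongrightarrow> c"
  shows "(\<lambda>N. real (g N choose k) / real N ^ k) \<longlonglongrightarrow> c ^ k / fact k"
proof -
  have "(\<lambda>N. (\<Prod>i=0..<k. real (g N) / real N - real i / real N) / fact k)
      \<longlonglongrightarrow> (\<Prod>i=0..<k. c - 0) / fact k"
    by (intro tendsto_intros assms lim_const_over_n) simp
  moreover have "(\<Prod>i=0..<k. real (g N) / real N - real i / real N) / fact k =
      real (g N choose k) / real N ^ k" for N
    by (simp add: binomial_gbinomial gbinomial_prod_rev prod_dividef flip: diff_divide_distrib)
  ultimately show ?thesis by simp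
qed

lemma tendsto_linear_over_n:
  "(\<lambda>N. real (c * N + d) / real N) \<longlonglongrightarrow> real c"
proof -
  have "(\<lambda>N. real c + real d / real N) \<longlonglongrightarrow> real c + 0"
    by (intro tendsto_intros lim_const_over_n)
  then have "(\<lambda>N. real c + real d / real N) \<longlonglongrightarrow> real c" by simp
  then show ?thesis
    by (rule Lim_transform_eventually)
      (auto intro!: eventually_sequentiallyI[of 1] simp: field_simps)
qed

lemma tendsto_linear_minus_one_over_n:
  "(\<lambda>N. real (c * N - 1) / real N) \<longlonglongrightarrow> real c"
proof (cases "c = 0")
  case False
  have "(\<lambda>N. real c - 1 / real N) \<longlonglongrightarrow> real c - 0"
    by (intro tendsto_intros lim_1_over_n)
  then have "(\<lambda>N. real c - 1 / real N) \<longlonglongrightarrow> real c" by simp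
  then show ?thesis
    by (rule Lim_transform_eventually)
      (use False in \<open>auto intro!: eventually_sequentiallyI[of 1] simp: field_simps of_nat_diff\<close>)
qed simp

text \<open>Only products of full degree \<open>m\<close> survive the division by
  \<open>N ^ m\<close>; those of smaller degree tend to 0.\<close>

lemma tendsto_choose_prod:
  fixes g h :: "nat \<Rightarrow> nat"
  assumes g: "(\<lambda>N. real (g N) / real N) \<longlonglongrightarrow> c"
    and h: "(\<lambda>N. real (h N) / real N) \<longlonglongrightarrow> d"
    and kl: "k + l \<le> m"
  shows "(\<lambda>N. real ((g N choose k) * (h N choose l)) / real N ^ m)
    \<longlonglongrightarrow> (if k + l = m then c ^ k / fact k * (d ^ l / fact l) else 0)"
proof -
  have "(\<lambda>N. (1 / real N) ^ (m - (k + l))) \<longlonglongrightarrow> 0 ^ (m - (k + l))"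
    by (intro tendsto_intros lim_1_over_n)
  then have "(\<lambda>N. real (g N choose k) / real N ^ k * (real (h N choose l) / real N ^ l) *
      (1 / real N) ^ (m - (k + l))) \<longlonglongrightarrow>
      c ^ k / fact k * (d ^ l / fact l) * 0 ^ (m - (k + l))"
    by (intro tendsto_mult tendsto_choose_scaled g h)
  moreover have "c ^ k / fact k * (d ^ l / fact l) * 0 ^ (m - (k + l)) =
      (if k + l = m then c ^ k / fact k * (d ^ l / fact l) else 0)"
    using kl by (auto simp: power_0_left)
  moreover have "real (g N choose k) / real N ^ k * (real (h N choose l) / real N ^ l) *
      (1 / real N) ^ (m - (k + l)) = real ((g N choose k) * (h N choose l)) / real N ^ m" for N
  proof -
    have "real N ^ m = real N ^ k * real N ^ l * real N ^ (m - (k + l))"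
      using kl by (simp flip: power_add)
    then show ?thesis by (simp add: power_one_over)
  qed
  ultimately show ?thesis by simp
qed

lemma coeff_one_two_power:
  "coeff ([:1, 2:] ^ m) k = (2 ^ k * real (m choose k))"
proof (cases "k \<le> m")
  case False
  then have "degree ([:1, 2:] ^ m :: real poly) < k"
    by (simp add: degree_power_eq)
  with False show ?thesis by (simp add: coeff_eq_0)
qed (simp add: coeff_linear_poly_power)

text \<open>The identity \<open>enum\<close> is evaluated along \<open>M = N\<close>,
  \<open>a = p * N\<close> and divided by \<open>N ^ (2 * n - 1)\<close>. In the limit it becomes an
  equality of polynomials in \<open>p\<close>, and the coefficient of \<open>p ^ (i - 1)\<close>
  isolates the wanted count. The power of 2 in the result comes from the linear growth rate
  \<open>1 + 2 * p\<close> of \<open>M + 2 * a\<close>.\<close>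

lemma top_counts_from_enumerator:
  fixes I J :: "'s \<Rightarrow> nat"
  assumes S: "finite S" and n: "n \<ge> 1" and le: "\<And>s. s \<in> S \<Longrightarrow> I s + J s \<le> n"
    and enum: "\<And>a M. a \<ge> 1 \<Longrightarrow>
      (\<Sum>s\<in>S. (if I s = 0 then 0 else (a - 1) choose (I s - 1)) * ((M + n) choose (n + J s)))
        + ((M + n) choose Suc n) * ((M + 2 * a + n) choose (n - 1))
      = ((M + Suc n) choose Suc n) * ((M + 2 * a + n - 1) choose (n - 1))"
    and i: "1 \<le> i" "i \<le> n"
  shows "real (card {s\<in>S. I s = i \<and> J s = n - i}) =
    2 ^ (i - 1) * (real (i + 1) * fact (2 * n - i)) / (fact (n - i) * fact (n + 1))"
proof -
  define A where "A p = (\<Sum>s\<in>S. if I s \<ge> 1 \<and> I s + J s = n then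
      real p ^ (I s - 1) / (fact (I s - 1) * fact (n + J s)) else 0)" for p :: nat
  \<comment> \<open>The quotient of \<open>real (n - 1)\<close> by \<open>fact (n - 1)\<close>
    stands for the reciprocal of \<open>fact (n - 2)\<close> and correctly gives 0 when
    \<open>n = 1\<close>.\<close>
  define B where "B p = (1 + 2 * real p) ^ (n - 1) / (fact n * fact (n - 1)) -
      real (n - 1) * (1 + 2 * real p) ^ (n - 2) / (fact (n + 1) * fact (n - 1))" for p :: nat
  have eval: "A p = B p" if p: "p \<ge> 1" for p
  proof -
    define u where "u N = (\<Sum>s\<in>S. (if I s = 0 then 0 else (p * N - 1) choose (I s - 1)) *
        ((N + n) choose (n + J s)))" for N
    define Y where "Y N = N + 2 * (p * N) + n - 1" for N
    \<comment> \<open>Both products in \<open>enum\<close> have degree 2n. Pascal's rule on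
      \<open>Suc (Y N) choose (n - 1)\<close> and on \<open>(N + Suc n) choose Suc n\<close> removes
      the common top term, and \<open>v\<close> is the remaining difference of degree 2n -
      1.\<close>
    define v where "v N = real (((N + n) choose n) * (Y N choose (n - 1))) -
      (if n = 1 then 0 else real (((N + n) choose Suc n) * (Y N choose (n - 2))))" for N
    have "(\<lambda>N. \<Sum>s\<in>S. if I s = 0 then 0 else
        real (((p * N - 1) choose (I s - 1)) * ((N + n) choose (n + J s))) / real N ^ (2 * n - 1))
      \<longlonglongrightarrow> A p"
      unfolding A_def
    proof (rule tendsto_sum)
      fix s assume s: "s \<in> S"
      show "(\<lambda>N. if I s = 0 then 0 else
          real (((p * N - 1) choose (I s - 1)) * ((N + n) choose (n + J s))) / real N ^ (2 * n - 1))
        \<longlonglongrightarrow> (if I s \<ge> 1 \<and> I s + J s = n then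
          real p ^ (I s - 1) / (fact (I s - 1) * fact (n + J s)) else 0)"
      proof (cases "I s = 0")
        case False
        have "(\<lambda>N. real (((p * N - 1) choose (I s - 1)) * ((1 * N + n) choose (n + J s)))
            / real N ^ (2 * n - 1)) \<longlonglongrightarrow> (if I s - 1 + (n + J s) = 2 * n - 1
            then real p ^ (I s - 1) / fact (I s - 1) * (real 1 ^ (n + J s) / fact (n + J s)) else 0)"
          using le[OF s] False n
          by (intro tendsto_choose_prod tendsto_linear_over_n tendsto_linear_minus_one_over_n) auto
        moreover have "I s - 1 + (n + J s) = 2 * n - 1 \<longleftrightarrow> I s + J s = n"
          using False n by auto
        ultimately show ?thesis
          using False by (cases "I s + J s = n") simp_all
      qed simp
    qed
    also have "(\<lambda>N. \<Sum>s\<in>S. if I s = 0 then 0 else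
        real (((p * N - 1) choose (I s - 1)) * ((N + n) choose (n + J s))) / real N ^ (2 * n - 1))
      = (\<lambda>N. real (u N) / real N ^ (2 * n - 1))"
      by (auto simp: u_def sum_divide_distrib fun_eq_iff intro!: sum.cong)
    finally have lim_u: "(\<lambda>N. real (u N) / real N ^ (2 * n - 1)) \<longlonglongrightarrow> A p" .
    have Y: "(\<lambda>N. real (Y N) / real N) \<longlonglongrightarrow> 1 + 2 * real p"
      using tendsto_linear_over_n[of "1 + 2 * p" "n - 1"] n by (simp add: Y_def algebra_simps)
    have N: "(\<lambda>N. real (N + n) / real N) \<longlonglongrightarrow> 1"
      using tendsto_linear_over_n[of 1 n] by simp
    have lim_v: "(\<lambda>N. v N / real N ^ (2 * n - 1)) \<longlonglongrightarrow> B p"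
    proof (cases "n = 1")
      case True
      show ?thesis
        using tendsto_choose_prod[OF N Y, of n "n - 1" "2 * n - 1"] True
        by (simp add: v_def B_def)
    next
      case False
      with n obtain k where k: "n = Suc (Suc k)"
        by (metis One_nat_def Suc_le_D old.nat.exhaust)
      have "(\<lambda>N. real (((N + n) choose n) * (Y N choose (n - 1))) / real N ^ (2 * n - 1)
          - real (((N + n) choose Suc n) * (Y N choose (n - 2))) / real N ^ (2 * n - 1))
        \<longlonglongrightarrow> (if n + (n - 1) = 2 * n - 1 then 1 ^ n / fact n * ((1 + 2 * real p) ^ (n - 1) / fact (n - 1)) else 0)
          - (if Suc n + (n - 2) = 2 * n - 1 then 1 ^ Suc n / fact (Suc n) * ((1 + 2 * real p) ^ (n - 2) / fact (n - 2)) else 0)"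
        using k by (intro tendsto_diff tendsto_choose_prod N Y) auto
      moreover have "(if n + (n - 1) = 2 * n - 1 then 1 ^ n / fact n * ((1 + 2 * real p) ^ (n - 1) / fact (n - 1)) else 0)
          - (if Suc n + (n - 2) = 2 * n - 1 then 1 ^ Suc n / fact (Suc n) * ((1 + 2 * real p) ^ (n - 2) / fact (n - 2)) else 0) = B p"
        by (simp add: B_def k divide_simps del: of_nat_Suc)
      ultimately show ?thesis
        using False by (simp add: v_def diff_divide_distrib)
    qed
    have "real (u N) = v N" if N: "N \<ge> 1" for N
    proof -
      have "u N + ((N + n) choose Suc n) * (Suc (Y N) choose (n - 1))
          = ((N + Suc n) choose Suc n) * (Y N choose (n - 1))"
        using enum[of "p * N" N] p N n by (simp add: u_def Y_def)
      moreover have "Suc (Y N) choose (n - 1) = (Y N choose (n - 1)) +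
          (if n = 1 then 0 else Y N choose (n - 2))"
      proof -
        obtain m where "n = Suc m" using n by (cases n) auto
        then show ?thesis by (cases m) auto
      qed
      moreover have "(N + Suc n) choose Suc n = ((N + n) choose n) + ((N + n) choose Suc n)"
        by simp
      moreover have "real x = real (c1 * e) - real (c2 * f)"
        if "x + c2 * d = c3 * e" "d = e + f" "c3 = c1 + c2" for x c1 c2 c3 d e f :: nat
      proof -
        have "x + c2 * f = c1 * e" using that by (simp add: algebra_simps)
        then show ?thesis by linarith
      qed
      ultimately have "real (u N) = real (((N + n) choose n) * (Y N choose (n - 1))) -
          real (((N + n) choose Suc n) * (if n = 1 then 0 else Y N choose (n - 2)))"
        by blast
      then show ?thesis by (simp add: v_def)
    qed
    then have "(\<lambda>N. real (u N) / real N ^ (2 * n - 1)) \<longlonglongrightarrow> B p"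
      using lim_v by (elim Lim_transform_eventually) (auto intro!: eventually_sequentiallyI[of 1])
    with lim_u show ?thesis by (rule LIMSEQ_unique)
  qed
  define PA where "PA = (\<Sum>s\<in>S. if I s \<ge> 1 \<and> I s + J s = n then
      monom (1 / (fact (I s - 1) * fact (n + J s)) :: real) (I s - 1) else 0)"
  define PB where "PB = smult (1 / (fact n * fact (n - 1)) :: real) ([:1, 2:] ^ (n - 1)) -
      smult (real (n - 1) / (fact (n + 1) * fact (n - 1))) ([:1, 2:] ^ (n - 2))"
  have PA: "poly PA (real p) = A p" for p
    by (auto simp: PA_def A_def poly_sum poly_monom intro!: sum.cong)
  have PB: "poly PB (real p) = B p" for p
    by (simp add: PB_def B_def algebra_simps)
  \<comment> \<open>The two polynomials agree at every positive integer, hence at infinitely many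
    points.\<close>
  have "PA - PB = 0"
  proof (rule ccontr)
    assume "PA - PB \<noteq> 0"
    then have "finite {x. poly (PA - PB) x = 0}" by (rule poly_roots_finite)
    moreover have "real ` {1..} \<subseteq> {x. poly (PA - PB) x = 0}"
      using eval by (auto simp: PA PB)
    ultimately have "finite (real ` {1..})" by (rule finite_subset[rotated])
    then show False by (simp add: finite_image_iff infinite_Ici)
  qed
  then have coeffs: "coeff PA (i - 1) = coeff PB (i - 1)" by simp
  have coeff_PA: "coeff PA (i - 1) = real (card {s\<in>S. I s = i \<and> J s = n - i}) /
      (fact (i - 1) * fact (2 * n - i))"
  proof -
    have "coeff PA (i - 1) = (\<Sum>s\<in>S. if I s = i \<and> J s = n - i
        then 1 / (fact (i - 1) * fact (2 * n - i)) else 0)"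
      unfolding PA_def coeff_sum
    proof (rule sum.cong[OF refl])
      fix s assume s: "s \<in> S"
      have "I s = i \<and> J s = n - i \<longleftrightarrow> (I s \<ge> 1 \<and> I s + J s = n) \<and> I s - 1 = i - 1"
        using i by auto
      moreover have "n + (n - i) = 2 * n - i" using i by auto
      ultimately show "coeff (if 1 \<le> I s \<and> I s + J s = n then
          monom (1 / (fact (I s - 1) * fact (n + J s))) (I s - 1) else 0) (i - 1) =
        (if I s = i \<and> J s = n - i then 1 / (fact (i - 1) * fact (2 * n - i)) else (0::real))"
        by (auto simp: mult_2 add_ac)
    qed
    then show ?thesis
      using S by (simp flip: sum.inter_filter)
  qed
  have coeff_PB: "coeff PB (i - 1) = 2 ^ (i - 1) * real (i + 1) /
      (fact (i - 1) * fact (n - i) * fact (n + 1))"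
  proof -
    have absorb: "real (n - 1) * real ((n - 2) choose (i - 1)) = real (n - i) * real ((n - 1) choose (i - 1))"
    proof -
      have "(n - 1) * ((n - 2) choose (i - 1)) = (n - i) * ((n - 1) choose (i - 1))"
        using binomial_absorb_comp[of "n - 1" "i - 1"] i by (simp add: numeral_2_eq_2)
      then show ?thesis
        unfolding of_nat_mult[symmetric] by (rule arg_cong)
    qed
    have ch: "real ((n - 1) choose (i - 1)) = fact (n - 1) / (fact (i - 1) * fact (n - i))"
      using i by (subst binomial_fact) (auto simp: algebra_simps)
    have "coeff PB (i - 1) = 2 ^ (i - 1) * real ((n - 1) choose (i - 1)) / (fact n * fact (n - 1)) -
      2 ^ (i - 1) * (real (n - 1) * real ((n - 2) choose (i - 1))) / (fact (n + 1) * fact (n - 1))"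
      by (simp add: PB_def coeff_one_two_power algebra_simps)
    also have "\<dots> = 2 ^ (i - 1) * real ((n - 1) choose (i - 1)) / fact (n - 1) *
        (1 / fact n - real (n - i) / fact (n + 1))"
    proof -
      have *: "c * K / (F * G) - c * (d * K) / (E * G) = c * K / G * (1 / F - d / E)"
        for c K F G d E :: real
        by (simp add: divide_inverse algebra_simps)
      show ?thesis unfolding absorb by (rule *)
    qed
    also have "1 / fact n - real (n - i) / fact (n + 1) = real (i + 1) / fact (n + 1)"
      using i by (simp add: divide_simps of_nat_diff)
    finally show ?thesis unfolding ch by simp
  qed
  have "x = p * (q * G) / (E * D)"
    if "a = b" "a = x / (F * G)" "b = p * q / (F * E * D)" "F \<noteq> 0" "G \<noteq> 0"
    for a b x F G p q E D :: real
  proof -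
    have "x = p * q / (F * E * D) * (F * G)" using that by (metis nonzero_eq_divide_eq mult_eq_0_iff)
    then show ?thesis using that by simp
  qed
  from this[OF coeffs coeff_PA coeff_PB fact_nonzero fact_nonzero] show ?thesis .
qed

text \<open>Comparison in degree 2n: only \<open>J s = n\<close> survives on the left, and the right
  side contributes the difference of 1 / (n!)^2 and 1 / ((n + 1)! (n - 1)!), which is 1 / ((n + 1)
  (n!)^2).\<close>

lemma bottom_count_from_enumerator:
  fixes J :: "'s \<Rightarrow> nat"
  assumes S: "finite S" and n: "n \<ge> 1" and le: "\<And>s. s \<in> S \<Longrightarrow> J s \<le> n"
    and enum: "\<And>M. (\<Sum>s\<in>S. (M + n) choose (n + J s)) + ((M + n) choose Suc n) * ((M + n) choose (n - 1))
      = ((M + n) choose n) ^ 2"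
  shows "real (card {s\<in>S. J s = n}) = real ((2 * n) choose n) / real (n + 1)"
proof -
  have lin: "(\<lambda>N. real (N + n) / real N) \<longlonglongrightarrow> 1"
    using tendsto_linear_over_n[of 1 n] by simp
  \<comment> \<open>The factor \<open>(N + n) choose 0\<close> is 1 and brings the term into the
    shape of \<open>tendsto_choose_prod\<close>.\<close>
  have "(\<lambda>N. \<Sum>s\<in>S. real (((N + n) choose (n + J s)) * ((N + n) choose 0)) / real N ^ (2 * n))
    \<longlonglongrightarrow> (\<Sum>s\<in>S. if n + J s + 0 = 2 * n then 1 ^ (n + J s) / fact (n + J s) * (1 ^ 0 / fact 0) else 0)"
    using le by (intro tendsto_sum tendsto_choose_prod lin) (auto simp: mult_2)
  also have "(\<Sum>s\<in>S. if n + J s + 0 = 2 * n then 1 ^ (n + J s) / fact (n + J s) * (1 ^ 0 / fact 0) else 0)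
      = (\<Sum>s\<in>S. if J s = n then 1 / fact (2 * n) else (0::real))"
    by (intro sum.cong) (auto simp: mult_2)
  also have "\<dots> = real (card {s\<in>S. J s = n}) / fact (2 * n)"
    using S by (simp flip: sum.inter_filter)
  finally have lim1: "(\<lambda>N. \<Sum>s\<in>S. real (((N + n) choose (n + J s)) * ((N + n) choose 0)) / real N ^ (2 * n))
    \<longlonglongrightarrow> real (card {s\<in>S. J s = n}) / fact (2 * n)" .
  have "(\<lambda>N. real (((N + n) choose n) * ((N + n) choose n)) / real N ^ (2 * n) -
      real (((N + n) choose Suc n) * ((N + n) choose (n - 1))) / real N ^ (2 * n)) \<longlonglongrightarrow>
      (if n + n = 2 * n then 1 ^ n / fact n * (1 ^ n / fact n) else 0) -
      (if Suc n + (n - 1) = 2 * n then 1 ^ Suc n / fact (Suc n) * (1 ^ (n - 1) / fact (n - 1)) else 0)"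
    using n by (intro tendsto_diff tendsto_choose_prod lin) auto
  moreover have "real (((N + n) choose n) * ((N + n) choose n)) / real N ^ (2 * n) -
      real (((N + n) choose Suc n) * ((N + n) choose (n - 1))) / real N ^ (2 * n) =
      (\<Sum>s\<in>S. real (((N + n) choose (n + J s)) * ((N + n) choose 0)) / real N ^ (2 * n))" for N
    using arg_cong[OF enum[of N], of real]
    by (simp add: power2_eq_square flip: sum_divide_distrib diff_divide_distrib)
  ultimately have "(\<lambda>N. \<Sum>s\<in>S. real (((N + n) choose (n + J s)) * ((N + n) choose 0)) / real N ^ (2 * n))
    \<longlonglongrightarrow> 1 / (fact n * fact n) - 1 / (fact (Suc n) * fact (n - 1))"
    using n by simp
  with lim1 have "real (card {s\<in>S. J s = n}) / fact (2 * n) =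
      1 / (fact n * fact n) - 1 / (fact (Suc n) * fact (n - 1))"
    by (rule LIMSEQ_unique)
  moreover have "(fact n :: real) = real n * fact (n - 1)"
    using n by (simp add: fact_reduce)
  ultimately have "real (card {s\<in>S. J s = n}) / fact (2 * n) = 1 / (real (n + 1) * fact n * fact n)"
    using n by (simp add: divide_simps) (simp add: algebra_simps)
  moreover have "real ((2 * n) choose n) = fact (2 * n) / (fact n * fact n)"
    by (subst binomial_fact) (auto simp: mult_2)
  ultimately show ?thesis
  proof -
    have "x = C / m" if "x / F = 1 / (m * G * G)" "C = F / (G * G)" "F \<noteq> 0" for x F m G C :: real
    proof -
      have "x = F * (1 / (m * G * G))" using that by (metis nonzero_mult_div_cancel_left times_divide_eq_right)
      then show ?thesis using that by simp
    qed
    then show ?thesis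
      using \<open>_ = 1 / (real (n + 1) * fact n * fact n)\<close> \<open>real ((2 * n) choose n) = _\<close> by fastforce
  qed
qed

section \<open>Integer flows on the boundary of the root polytope\<close>

lemma Ints_sum_other:
  fixes f :: "'b \<Rightarrow> real"
  assumes "finite A" "sum f A \<in> \<int>" "a \<in> A" "f a \<notin> \<int>"
  shows "\<exists>b\<in>A. b \<noteq> a \<and> f b \<notin> \<int>"
proof (rule ccontr)
  assume "\<not> ?thesis"
  then have "sum f (A - {a}) \<in> \<int>" by (intro Ints_sum) auto
  moreover have "f a = sum f A - sum f (A - {a})"
    using assms by (simp add: sum.remove)
  ultimately show False using assms by (metis Ints_diff)
qed

text \<open>Every fibre has at least two elements. Applied to arrows and their tails or heads, this
  bounds the number of vertices of a graph without vertices of degree 1.\<close>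

lemma card_image_le_half:
  assumes "finite C" "\<And>a. a \<in> C \<Longrightarrow> \<exists>b\<in>C. b \<noteq> a \<and> f b = f a"
  shows "2 * card (f ` C) \<le> card C"
proof -
  have "2 * card (f ` C) = (\<Sum>y\<in>f ` C. (2::nat))" by simp
  also have "\<dots> \<le> (\<Sum>y\<in>f ` C. \<Sum>x | x \<in> C \<and> f x = y. 1)"
  proof (rule sum_mono)
    fix y assume "y \<in> f ` C"
    then obtain a where a: "a \<in> C" "f a = y" by blast
    with assms(2) obtain b where "b \<in> C" "b \<noteq> a" "f b = y" by metis
    then have "card {a, b} \<le> card {x. x \<in> C \<and> f x = y}"
      using a assms(1) by (intro card_mono) auto
    then show "(2::nat) \<le> (\<Sum>x | x \<in> C \<and> f x = y. 1)" using \<open>b \<noteq> a\<close> by simp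
  qed
  also have "\<dots> = card C"
    using sum.image_gen[OF assms(1), of "\<lambda>_. 1::nat" f] by (simp only: card_eq_sum)
  finally show ?thesis .
qed

section \<open>The boundary complex in coordinates\<close>

locale uniform_triangulation =
  fixes n :: nat and e :: "nat \<Rightarrow> 'a::euclidean_space" and \<Delta> :: "arrow set set"
  assumes n_pos: "n \<ge> 1"
    and basis: "bij_betw e {1..n+1} (Basis :: 'a set)"
    and triang: "uniform_flag_triangulation e n \<Delta>"
begin

abbreviation V :: "arrow \<Rightarrow> 'a" where "V \<equiv> arrow_vec e"

abbreviation P :: "'a set" where "P \<equiv> root_polytope e n"

lemmas complex = triang[unfolded uniform_flag_triangulation_def flag_complex_def abstract_complex_def,
    THEN conjunct1, THEN conjunct1]

lemmas faces_subset = complex[THEN conjunct1]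
  and empty_face = complex[THEN conjunct2, THEN conjunct1]
  and subface = complex[THEN conjunct2, THEN conjunct2, THEN conjunct2, THEN bspec, THEN spec, THEN mp]

lemma faces: "\<sigma> \<subseteq> arrows n" "finite \<sigma>" if "\<sigma> \<in> \<Delta>"
  using faces_subset that by blast+

lemma finite_arrows: "finite (arrows n)"
  by (rule finite_subset[of _ "{1..n+1} \<times> {1..n+1}"]) (auto simp: arrows_def)

lemma finite_complex: "finite \<Delta>"
  using faces(1) finite_arrows by (intro finite_subset[of \<Delta> "Pow (arrows n)"]) auto

lemma e_inner: "e k \<bullet> e l = (if k = l then 1 else 0)" if "k \<in> {1..n+1}" "l \<in> {1..n+1}"
proof -
  have "e k \<in> Basis" "e l \<in> Basis" using basis that by (auto simp: bij_betw_def)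
  moreover have "e k = e l \<longleftrightarrow> k = l"
    using basis that by (metis bij_betw_def inj_on_eq_iff)
  ultimately show ?thesis by (simp add: inner_Basis)
qed

lemma e_expand: "x = (\<Sum>l=1..n+1. (x \<bullet> e l) *\<^sub>R e l)"
proof -
  have "x = (\<Sum>b\<in>Basis. (x \<bullet> b) *\<^sub>R b)" by (simp add: euclidean_representation)
  also have "\<dots> = (\<Sum>l=1..n+1. (x \<bullet> e l) *\<^sub>R e l)"
    using sum.reindex_bij_betw[OF basis, of "\<lambda>b. (x \<bullet> b) *\<^sub>R b"] by simp
  finally show ?thesis .
qed

lemma e_eqI: "x = y" if "\<And>l. l \<in> {1..n+1} \<Longrightarrow> x \<bullet> e l = y \<bullet> e l"
  using that by (subst e_expand[of x], subst e_expand[of y]) (intro sum.cong, auto)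

lemma V_inner: "V a \<bullet> e l = (if snd a = l then 1 else 0) - (if fst a = l then 1 else 0)"
  if "a \<in> arrows n" "l \<in> {1..n+1}"
  using that e_inner[of _ l] by (auto simp: arrow_vec_def arrows_def inner_diff_left)

lemma inj_V: "inj_on V (arrows n)"
proof (rule inj_onI)
  fix a b assume a: "a \<in> arrows n" and b: "b \<in> arrows n" and eq: "V a = V b"
  have in_range: "fst a \<in> {1..n+1}" "snd a \<in> {1..n+1}" "fst a \<noteq> snd a"
    using a by (auto simp: arrows_def)
  have "V a \<bullet> e (fst a) = V b \<bullet> e (fst a)" "V a \<bullet> e (snd a) = V b \<bullet> e (snd a)"
    using eq by simp_all
  then have "fst a = fst b" "snd a = snd b"
    unfolding V_inner[OF a in_range(1)] V_inner[OF b in_range(1)] V_inner[OF a in_range(2)]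
      V_inner[OF b in_range(2)]
    using in_range(3) by (simp_all split: if_splits)
  then show "a = b" by (simp add: prod_eq_iff)
qed

lemma sum_image_V: "(\<Sum>y\<in>V ` \<sigma>. h y) = (\<Sum>a\<in>\<sigma>. h (V a))" if "\<sigma> \<in> \<Delta>"
  using inj_on_subset[OF inj_V faces(1)[OF that]] by (simp add: sum.reindex)

lemma combination_inner:
  "(\<Sum>a\<in>\<sigma>. lab a *\<^sub>R V a) \<bullet> e l = - net_flow \<sigma> lab l" if "\<sigma> \<in> \<Delta>" "l \<in> {1..n+1}"
proof -
  have "(\<Sum>a\<in>\<sigma>. lab a *\<^sub>R V a) \<bullet> e l = (\<Sum>a\<in>\<sigma>. (if snd a = l then lab a else 0) - (if fst a = l then lab a else 0))"
    unfolding inner_sum_left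
    using V_inner[OF _ that(2)] faces(1)[OF that(1)] by (intro sum.cong) auto
  also have "\<dots> = - net_flow \<sigma> lab l"
    using faces(2)[OF that(1)] by (simp add: net_flow_def sum_subtractf sum.inter_filter)
  finally show ?thesis .
qed

lemma V_in_P: "V a \<in> P" if "a \<in> arrows n"
  using that by (auto simp: root_polytope_def intro: hull_inc)

lemma bounded_P: "bounded P" and convex_P: "convex P" and closed_P: "closed P"
proof -
  have "compact P"
    using finite_arrows by (simp add: root_polytope_def finite_imp_compact_convex_hull)
  then show "bounded P" "closed P" by (auto simp: compact_imp_bounded compact_imp_closed)
qed (simp add: root_polytope_def)

text \<open>Reversing all arrows permutes them, so \<open>P\<close> is symmetric about 0; every
  segment from a point of \<open>P\<close> to 0 therefore extends beyond 0 within
  \<open>P\<close>.\<close>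

lemma zero_in_rel_interior: "0 \<in> rel_interior P"
proof -
  have "(1, 2) \<in> arrows n" using n_pos by (auto simp: arrows_def)
  then have "P \<noteq> {}" using V_in_P by blast
  have "(\<lambda>x. - x) ` V ` arrows n = V ` prod.swap ` arrows n"
    by (auto simp: image_image arrow_vec_def)
  also have "prod.swap ` arrows n = arrows n"
    by (auto simp: arrows_def image_iff)
  finally have sym: "(\<lambda>x. - x) ` V ` arrows n = V ` arrows n" .
  have "- x \<in> P" if "x \<in> P" for x
    using in_convex_hull_linear_image[of "\<lambda>x. - x" x "V ` arrows n"] that
    by (simp add: root_polytope_def sym linear_uminus)
  then have "\<exists>t>1. (1 - t) *\<^sub>R x + t *\<^sub>R 0 \<in> P" if "x \<in> P" for x
    using that by (intro exI[of _ 2]) simp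
  then show ?thesis
    using convex_rel_interior_iff[OF convex_P \<open>P \<noteq> {}\<close>] by blast
qed

lemma shrink_in_rel_interior: "c *\<^sub>R x \<in> rel_interior P" if "x \<in> P" "0 \<le> c" "c < 1"
  using rel_interior_convex_shrink[OF convex_P zero_in_rel_interior that(1), of "1 - c"] that
  by (simp add: algebra_simps)

lemma frontier_not_interior: "x \<notin> rel_interior P" "x \<in> P" if "x \<in> rel_frontier P"
  using that closed_P by (auto simp: rel_frontier_def)

lemmas boundary_conditions = triang[unfolded uniform_flag_triangulation_def, THEN conjunct2, THEN conjunct1]

lemmas boundary = boundary_conditions[unfolded triangulates_boundary_def, THEN conjunct1, rule_format]
  boundary_conditions[unfolded triangulates_boundary_def, THEN conjunct2, THEN conjunct1]
  boundary_conditions[unfolded triangulates_boundary_def, THEN conjunct2, THEN conjunct2]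

lemma face_in_frontier: "convex hull (V ` \<sigma>) \<subseteq> rel_frontier P" if "\<sigma> \<in> \<Delta>"
  using that unfolding boundary(3)[symmetric] by blast

lemma frontier_covered: "\<exists>\<sigma>\<in>\<Delta>. x \<in> convex hull (V ` \<sigma>)" if "x \<in> rel_frontier P"
  using that unfolding boundary(3)[symmetric] by blast

lemma face_intersection:
  "convex hull (V ` \<sigma>) \<inter> convex hull (V ` \<tau>) face_of convex hull (V ` \<sigma>)" if "\<sigma> \<in> \<Delta>" "\<tau> \<in> \<Delta>"
  by (rule boundary(2)[unfolded simplicial_complex_def, THEN conjunct2, THEN conjunct2, THEN conjunct2,
        rule_format]) (use that in blast)

text \<open>The midpoint of two consecutive arrows is half of \<open>e r - e p\<close>, which is an
  arrow vector or 0. It would lie in the relative interior, whereas the face lies in the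
  frontier.\<close>

lemma alternating: False if "\<sigma> \<in> \<Delta>" "(p, q) \<in> \<sigma>" "(q, r) \<in> \<sigma>"
proof -
  let ?m = "(1/2) *\<^sub>R V (p, q) + (1/2) *\<^sub>R V (q, r)"
  have arr: "(p, q) \<in> arrows n" "(q, r) \<in> arrows n" using faces(1) that by auto
  have "?m \<in> convex hull (V ` \<sigma>)"
    using that by (intro convexD[OF convex_convex_hull]) (auto intro: hull_inc)
  then have "?m \<notin> rel_interior P"
    using face_in_frontier[OF that(1)] frontier_not_interior by blast
  moreover have "?m = (1/2) *\<^sub>R (e r - e p)"
    by (simp add: arrow_vec_def algebra_simps)
  moreover have "e r - e p \<in> P"
  proof (cases "p = r")
    case True
    then show ?thesis using zero_in_rel_interior rel_interior_subset by auto
  next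
    case False
    with arr have "(p, r) \<in> arrows n" by (auto simp: arrows_def)
    from V_in_P[OF this] show ?thesis by (simp add: arrow_vec_def)
  qed
  ultimately show False using shrink_in_rel_interior[of "e r - e p" "1/2"] by simp
qed

text \<open>Summing the coordinates at the heads gives a linear functional equal to 1 on every arrow of
  the face, so an arbitrary linear relation is already an affine one.\<close>

lemma face_independent: "independent (V ` \<sigma>)" if "\<sigma> \<in> \<Delta>"
proof
  have fin: "finite (V ` \<sigma>)" using faces(2)[OF that] by simp
  assume "dependent (V ` \<sigma>)"
  then obtain u where u: "\<exists>y\<in>V ` \<sigma>. u y \<noteq> 0" "(\<Sum>y\<in>V ` \<sigma>. u y *\<^sub>R y) = 0"
    using dependent_finite[OF fin] by blast
  define h where "h = (\<Sum>l\<in>snd ` \<sigma>. e l)"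
  have one: "V a \<bullet> h = 1" if a: "a \<in> \<sigma>" for a
  proof -
    have "snd ` \<sigma> \<subseteq> {1..n+1}" using faces(1)[OF \<open>\<sigma> \<in> \<Delta>\<close>] by (auto simp: arrows_def)
    have "fst a \<notin> snd ` \<sigma>"
      using alternating[OF \<open>\<sigma> \<in> \<Delta>\<close>] a by (metis imageE prod.collapse)
    have "a \<in> arrows n" using faces(1)[OF \<open>\<sigma> \<in> \<Delta>\<close>] a by auto
    have "V a \<bullet> e l = (if snd a = l then 1 else 0)" if "l \<in> snd ` \<sigma>" for l
    proof -
      have l: "l \<in> {1..n+1}" "fst a \<noteq> l" using that \<open>snd ` \<sigma> \<subseteq> _\<close> \<open>fst a \<notin> _\<close> by blast+
      show ?thesis using V_inner[OF \<open>a \<in> arrows n\<close> l(1)] l(2) by simp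
    qed
    then have "V a \<bullet> h = (\<Sum>l\<in>snd ` \<sigma>. if snd a = l then 1 else 0)"
      unfolding h_def inner_sum_right by (intro sum.cong) auto
    then show ?thesis using faces(2)[OF \<open>\<sigma> \<in> \<Delta>\<close>] a by simp
  qed
  have "sum u (V ` \<sigma>) = (\<Sum>y\<in>V ` \<sigma>. u y *\<^sub>R y) \<bullet> h"
    unfolding inner_sum_left using one by (intro sum.cong) auto
  then have "sum u (V ` \<sigma>) = 0" using u by simp
  then have "affine_dependent (V ` \<sigma>)"
    using affine_dependent_explicit_finite[OF fin] u by blast
  then show False using boundary(1)[OF that] by blast
qed

lemma face_coefficients_unique:
  assumes "\<sigma> \<in> \<Delta>" "(\<Sum>a\<in>\<sigma>. lab a *\<^sub>R V a) = (\<Sum>a\<in>\<sigma>. lab' a *\<^sub>R V a)" "a \<in> \<sigma>"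
  shows "lab a = lab' a"
proof -
  have inj: "inj_on V \<sigma>" using inj_V faces(1)[OF assms(1)] by (rule inj_on_subset)
  define u where "u y = lab (the_inv_into \<sigma> V y) - lab' (the_inv_into \<sigma> V y)" for y
  have u: "u (V b) = lab b - lab' b" if "b \<in> \<sigma>" for b
    using inj that by (simp add: u_def the_inv_into_f_f)
  have "(\<Sum>y\<in>V ` \<sigma>. u y *\<^sub>R y) = 0"
    using assms(2) u by (simp add: sum_image_V[OF assms(1)] scaleR_diff_left sum_subtractf)
  then have "u (V a) = 0"
    using independentD[OF face_independent[OF assms(1)], of "V ` \<sigma>" u "V a"] faces(2)[OF assms(1)] assms(3)
    by auto
  then show ?thesis using u[OF assms(3)] by simp
qed

lemma normalized_in_rel_interior:
  assumes "\<sigma> \<in> \<Delta>" "\<sigma> \<noteq> {}" "\<And>a. a \<in> \<sigma> \<Longrightarrow> lab a > 0"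
  shows "(1 / sum lab \<sigma>) *\<^sub>R (\<Sum>a\<in>\<sigma>. lab a *\<^sub>R V a) \<in> rel_interior (convex hull (V ` \<sigma>))"
proof -
  have inj: "inj_on V \<sigma>" using inj_V faces(1)[OF assms(1)] by (rule inj_on_subset)
  have s: "sum lab \<sigma> > 0" using assms faces(2) by (intro sum_pos) auto
  define u where "u y = lab (the_inv_into \<sigma> V y) / sum lab \<sigma>" for y
  have u: "u (V b) = lab b / sum lab \<sigma>" if "b \<in> \<sigma>" for b
    using inj that by (simp add: u_def the_inv_into_f_f)
  have "(\<forall>y\<in>V ` \<sigma>. 0 < u y)" using u s assms(3) by simp
  moreover have "sum u (V ` \<sigma>) = 1"
    using u s by (simp add: sum_image_V[OF assms(1)] flip: sum_divide_distrib)
  moreover have "(\<Sum>y\<in>V ` \<sigma>. u y *\<^sub>R y) = (1 / sum lab \<sigma>) *\<^sub>R (\<Sum>a\<in>\<sigma>. lab a *\<^sub>R V a)"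
    using u by (simp add: sum_image_V[OF assms(1)] scaleR_sum_right)
  ultimately show ?thesis
    unfolding rel_interior_convex_hull_explicit[OF boundary(1)[OF assms(1)]] by blast
qed

text \<open>The open cones over different faces are disjoint. A ray from the interior point 0 meets
  the frontier only once, so both combinations have the same coefficient sum. The normalized point
  is then relatively interior to both simplices, and these must coincide.\<close>

lemma positive_combination_unique:
  assumes \<sigma>: "\<sigma> \<in> \<Delta>" and \<tau>: "\<tau> \<in> \<Delta>"
    and pos: "\<And>a. a \<in> \<sigma> \<Longrightarrow> lab a > 0" "\<And>a. a \<in> \<tau> \<Longrightarrow> lab' a > 0"
    and eq: "(\<Sum>a\<in>\<sigma>. lab a *\<^sub>R V a) = (\<Sum>a\<in>\<tau>. lab' a *\<^sub>R V a)"
  shows "\<sigma> = \<tau>" "\<And>a. a \<in> \<sigma> \<Longrightarrow> lab a = lab' a"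
proof -
  have nonzero: "(\<Sum>a\<in>\<rho>. m a *\<^sub>R V a) \<noteq> 0"
    if "\<rho> \<in> \<Delta>" "\<rho> \<noteq> {}" "\<And>a. a \<in> \<rho> \<Longrightarrow> m a > 0" for \<rho> and m :: "arrow \<Rightarrow> real"
  proof
    assume "(\<Sum>a\<in>\<rho>. m a *\<^sub>R V a) = 0"
    then have "0 \<in> rel_interior (convex hull (V ` \<rho>))"
      using normalized_in_rel_interior[OF that(1,2), of m] that(3) by (simp only: scaleR_zero_right)
    then have "0 \<in> rel_frontier P"
      using face_in_frontier[OF that(1)] rel_interior_subset by blast
    then show False using frontier_not_interior(1) zero_in_rel_interior by blast
  qed
  show "\<sigma> = \<tau>"
  proof (cases "\<sigma> = {} \<or> \<tau> = {}")
    case True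
    then show ?thesis using nonzero[OF \<sigma>, of lab] nonzero[OF \<tau>, of lab'] pos eq by fastforce
  next
    case False
    define X where "X = (\<Sum>a\<in>\<sigma>. lab a *\<^sub>R V a)"
    have s: "sum lab \<sigma> > 0" "sum lab' \<tau> > 0"
      using False pos faces(2) \<sigma> \<tau> by (auto intro!: sum_pos)
    have x: "(1 / sum lab \<sigma>) *\<^sub>R X \<in> rel_interior (convex hull (V ` \<sigma>))"
      "(1 / sum lab' \<tau>) *\<^sub>R X \<in> rel_interior (convex hull (V ` \<tau>))"
      using normalized_in_rel_interior[OF \<sigma>, of lab] normalized_in_rel_interior[OF \<tau>, of lab']
        False pos eq by (auto simp: X_def)
    then have fr: "(1 / sum lab \<sigma>) *\<^sub>R X \<in> rel_frontier P" "(1 / sum lab' \<tau>) *\<^sub>R X \<in> rel_frontier P"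
      using face_in_frontier \<sigma> \<tau> rel_interior_subset by blast+
    have no_less: "\<not> s' < t'" if "s' > 0" "t' > 0" "(1 / s') *\<^sub>R X \<in> rel_frontier P"
      "(1 / t') *\<^sub>R X \<in> rel_frontier P" for s' t' :: real
    proof
      assume "s' < t'"
      then have "(s' / t') *\<^sub>R ((1 / s') *\<^sub>R X) \<in> rel_interior P"
        using that frontier_not_interior(2) by (intro shrink_in_rel_interior) auto
      moreover have "(s' / t') *\<^sub>R ((1 / s') *\<^sub>R X) = (1 / t') *\<^sub>R X" using that by simp
      ultimately show False using frontier_not_interior(1)[OF that(4)] that(1) by simp
    qed
    have same: "sum lab \<sigma> = sum lab' \<tau>"
      using no_less[OF s fr] no_less[OF s(2,1) fr(2,1)] by simp
    \<comment> \<open>The intersection is a face of the first hull that contains one of its relative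
      interior points, hence it is the whole hull.\<close>
    have hull_sub: "convex hull (V ` \<rho>) \<subseteq> convex hull (V ` \<rho>')"
      if "\<rho> \<in> \<Delta>" "\<rho>' \<in> \<Delta>" "y \<in> rel_interior (convex hull (V ` \<rho>))" "y \<in> convex hull (V ` \<rho>')" for \<rho> \<rho>' y
      using subset_of_face_of[OF face_intersection[OF that(1,2)], of "convex hull (V ` \<rho>)"] that(3,4)
        rel_interior_subset by blast
    have "convex hull (V ` \<sigma>) = convex hull (V ` \<tau>)"
      using x same \<sigma> \<tau> rel_interior_subset by (intro equalityI hull_sub) auto
    then have "V ` \<sigma> = V ` \<tau>"
      using extreme_point_of_convex_hull_affine_independent[OF boundary(1)[OF \<sigma>]]
        extreme_point_of_convex_hull_affine_independent[OF boundary(1)[OF \<tau>]]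
      by auto
    then show ?thesis
      using inj_on_image_eq_iff[OF inj_V faces(1)[OF \<sigma>] faces(1)[OF \<tau>]] by simp
  qed
  then show "\<And>a. a \<in> \<sigma> \<Longrightarrow> lab a = lab' a"
    using face_coefficients_unique[OF \<sigma>] eq by blast
qed

text \<open>As for forests: arrows with all ends in \<open>W\<close> lie in the span of the
  differences \<open>e l - e l0\<close>, of dimension at most \<open>card W - 1\<close>. With all
  vertices this bounds faces, with the ends of a subset it forces integrality.\<close>

lemma card_independent_arrows:
  assumes C: "C \<subseteq> arrows n" "C \<noteq> {}" "finite C" and ind: "independent (V ` C)"
    and W: "finite W" "fst ` C \<subseteq> W" "snd ` C \<subseteq> W"
  shows "card C < card W"
proof -
  obtain l0 where l0: "l0 \<in> W" using C W by blast
  let ?B = "(\<lambda>l. e l - e l0) ` (W - {l0})"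
  have gen: "e l - e l0 \<in> span ?B" if "l \<in> W" for l
    using that by (cases "l = l0") (auto intro: span_base simp: span_zero)
  have "V a \<in> span ?B" if "a \<in> C" for a
  proof -
    have "V a = (e (snd a) - e l0) - (e (fst a) - e l0)" by (simp add: arrow_vec_def)
    also have "\<dots> \<in> span ?B" by (rule span_diff[OF gen gen]) (use that W in auto)
    finally show ?thesis .
  qed
  then have "V ` C \<subseteq> span ?B" by blast
  then have "card (V ` C) \<le> card ?B"
    using independent_span_bound[OF _ ind, of ?B] W by simp
  moreover have "card (V ` C) = card C"
    using inj_on_subset[OF inj_V C(1)] by (simp add: card_image)
  moreover have "card ?B \<le> card (W - {l0})" using W by (intro card_image_le) auto
  moreover have "card (W - {l0}) < card W" using W(1) l0 by (rule card_Diff1_less)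
  ultimately show ?thesis by linarith
qed

lemma card_face_le: "card \<sigma> \<le> n" if "\<sigma> \<in> \<Delta>"
proof (cases "\<sigma> = {}")
  case False
  have "card \<sigma> < card {1..n+1}"
    using faces[OF that] False face_independent[OF that]
    by (intro card_independent_arrows) (auto simp: arrows_def)
  then show ?thesis by simp
qed simp

text \<open>The arrows with a non-integral coefficient would form a graph of minimum degree at least 2,
  which has too many edges to be independent.\<close>

lemma integral_coefficients:
  assumes \<sigma>: "\<sigma> \<in> \<Delta>" and int: "\<And>l. l \<in> {1..n+1} \<Longrightarrow> net_flow \<sigma> (lab :: arrow \<Rightarrow> real) l \<in> \<int>"
    and "a \<in> \<sigma>"
  shows "lab a \<in> \<int>"
proof (rule ccontr)
  assume "lab a \<notin> \<int>"
  define C where "C = {a\<in>\<sigma>. lab a \<notin> \<int>}"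
  have "a \<in> C" using \<open>lab a \<notin> \<int>\<close> assms(3) by (simp add: C_def)
  then have "C \<noteq> {}" by blast
  moreover have "C \<subseteq> \<sigma>" by (auto simp: C_def)
  ultimately have C: "C \<subseteq> \<sigma>" "C \<noteq> {}" "finite C" "C \<subseteq> arrows n"
    using faces[OF \<sigma>] by (auto intro: finite_subset)
  have fst_deg: "\<exists>c\<in>C. c \<noteq> b \<and> fst c = fst b" if b: "b \<in> C" for b
  proof -
    \<comment> \<open>No arrow of the face enters \<open>fst b\<close>, so the integral flow there
      is a sum of outgoing labels; one non-integral label needs a second one.\<close>
    have "snd x \<noteq> fst b" if "x \<in> \<sigma>" for x
      using alternating[OF \<sigma>, of "fst x" "snd x" "snd b"] that b C(1) by (metis prod.collapse subsetD)
    then have "{x. x \<in> \<sigma> \<and> snd x = fst b} = {}" by blast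
    then have "net_flow \<sigma> lab (fst b) = (\<Sum>x | x \<in> \<sigma> \<and> fst x = fst b. lab x)"
      unfolding net_flow_def by (simp only: sum.empty diff_0_right)
    moreover have "fst b \<in> {1..n+1}" using b C by (auto simp: arrows_def)
    ultimately have "(\<Sum>x | x \<in> \<sigma> \<and> fst x = fst b. lab x) \<in> \<int>" using int by metis
    moreover have "finite {x. x \<in> \<sigma> \<and> fst x = fst b}" using faces(2)[OF \<sigma>] by simp
    moreover have "b \<in> {x. x \<in> \<sigma> \<and> fst x = fst b}" "lab b \<notin> \<int>" using b by (simp_all add: C_def)
    ultimately have "\<exists>c\<in>{x. x \<in> \<sigma> \<and> fst x = fst b}. c \<noteq> b \<and> lab c \<notin> \<int>"
      by (intro Ints_sum_other)
    then show ?thesis by (auto simp: C_def)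
  qed
  have snd_deg: "\<exists>c\<in>C. c \<noteq> b \<and> snd c = snd b" if b: "b \<in> C" for b
  proof -
    have "fst x \<noteq> snd b" if "x \<in> \<sigma>" for x
      using alternating[OF \<sigma>, of "fst b" "snd b" "snd x"] that b C(1) by (metis prod.collapse subsetD)
    then have "{x. x \<in> \<sigma> \<and> fst x = snd b} = {}" by blast
    then have "net_flow \<sigma> lab (snd b) = - (\<Sum>x | x \<in> \<sigma> \<and> snd x = snd b. lab x)"
      unfolding net_flow_def by (simp only: sum.empty diff_0)
    moreover have "snd b \<in> {1..n+1}" using b C by (auto simp: arrows_def)
    ultimately have "- (\<Sum>x | x \<in> \<sigma> \<and> snd x = snd b. lab x) \<in> \<int>" using int by metis
    from Ints_minus[OF this] have "(\<Sum>x | x \<in> \<sigma> \<and> snd x = snd b. lab x) \<in> \<int>" by simp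
    moreover have "finite {x. x \<in> \<sigma> \<and> snd x = snd b}" using faces(2)[OF \<sigma>] by simp
    moreover have "b \<in> {x. x \<in> \<sigma> \<and> snd x = snd b}" "lab b \<notin> \<int>" using b by (simp_all add: C_def)
    ultimately have "\<exists>c\<in>{x. x \<in> \<sigma> \<and> snd x = snd b}. c \<noteq> b \<and> lab c \<notin> \<int>"
      by (intro Ints_sum_other)
    then show ?thesis by (auto simp: C_def)
  qed
  have "card (fst ` C \<union> snd ` C) \<le> card (fst ` C) + card (snd ` C)" by (rule card_Un_le)
  also have "\<dots> \<le> card C"
    using card_image_le_half[OF C(3), of fst] card_image_le_half[OF C(3), of snd] fst_deg snd_deg by force
  finally have "card (fst ` C \<union> snd ` C) \<le> card C" .
  moreover have "card C < card (fst ` C \<union> snd ` C)"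
    using C face_independent[OF subface[OF \<sigma> C(1)]] by (intro card_independent_arrows) auto
  ultimately show False by simp
qed

text \<open>The ray from 0 in direction \<open>X\<close> hits the boundary in some face. Rescaling
  the convex coefficients and dropping the zeros gives a positive combination, and
  \<open>integral_coefficients\<close> makes it integral. The zero vector has no ray and belongs to
  the empty face.\<close>

lemma integer_flow_exists:
  fixes x :: "nat \<Rightarrow> int"
  assumes "(\<Sum>l=1..n+1. x l) = 0"
  shows "\<exists>\<sigma>\<in>\<Delta>. \<exists>lab :: arrow \<Rightarrow> nat. (\<forall>a\<in>\<sigma>. lab a > 0) \<and>
    (\<forall>l\<in>{1..n+1}. net_flow \<sigma> (int \<circ> lab) l = x l)"
proof (cases "\<forall>l\<in>{1..n+1}. x l = 0")
  case True
  then show ?thesis using empty_face by (intro bexI[of _ "{}"]) (auto simp: net_flow_def)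
next
  case False
  \<comment> \<open>The minus sign compensates for \<open>net_flow\<close> counting tails
    positively.\<close>
  define X where "X = (\<Sum>l=1..n+1. (- real_of_int (x l)) *\<^sub>R e l)"
  have X: "X \<bullet> e l = - real_of_int (x l)" if "l \<in> {1..n+1}" for l
  proof -
    have "X \<bullet> e l = (\<Sum>k=1..n+1. if k = l then - real_of_int (x k) else 0)"
      unfolding X_def inner_sum_left using e_inner[OF _ that] by (intro sum.cong) auto
    then show ?thesis using that by simp
  qed
  then have "X \<noteq> 0" using False by force
  have "0 \<in> P" using zero_in_rel_interior rel_interior_subset by blast
  \<comment> \<open>Coordinate sum 0 makes \<open>X\<close> a combination of arrows from 1, so it
    lies in the affine hull of \<open>P\<close> and the ray does reach the relative
    frontier.\<close>
  have "X = (\<Sum>l=1..n+1. (- real_of_int (x l)) *\<^sub>R (e l - e 1)) + (\<Sum>l=1..n+1. - real_of_int (x l)) *\<^sub>R e 1"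
    unfolding X_def scaleR_diff_right sum_subtractf scaleR_sum_left by (simp only: diff_add_cancel)
  also have "(\<Sum>l=1..n+1. - real_of_int (x l)) = 0"
    using assms by (simp add: sum_negf flip: of_int_sum)
  finally have X_eq: "X = (\<Sum>l=1..n+1. (- real_of_int (x l)) *\<^sub>R (e l - e 1))" by simp
  have "e l - e 1 \<in> span P" if "l \<in> {1..n+1}" for l
  proof (cases "l = 1")
    case False
    with that have "(1, l) \<in> arrows n" by (auto simp: arrows_def)
    from span_base[OF V_in_P[OF this]] show ?thesis by (simp add: arrow_vec_def)
  qed (simp add: span_zero)
  then have "X \<in> span P" unfolding X_eq by (intro span_sum span_scale)
  then have "0 + X \<in> affine hull P"
    using affine_hull_span_0[OF hull_inc[OF \<open>0 \<in> P\<close>]] by simp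
  from ray_to_rel_frontier[OF bounded_P zero_in_rel_interior this \<open>X \<noteq> 0\<close>]
  obtain d where d: "d > 0" "0 + d *\<^sub>R X \<in> rel_frontier P" by metis
  from d(2) have "d *\<^sub>R X \<in> rel_frontier P" by simp
  then obtain \<sigma> where \<sigma>: "\<sigma> \<in> \<Delta>" "d *\<^sub>R X \<in> convex hull (V ` \<sigma>)"
    using frontier_covered by blast
  then obtain u where u: "\<forall>y\<in>V ` \<sigma>. 0 \<le> u y" "(\<Sum>y\<in>V ` \<sigma>. u y *\<^sub>R y) = d *\<^sub>R X"
    using convex_hull_finite[of "V ` \<sigma>"] faces(2)[OF \<sigma>(1)] by auto
  define lab where "lab a = u (V a) / d" for a
  define \<tau> where "\<tau> = {a\<in>\<sigma>. lab a \<noteq> 0}"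
  have \<tau>: "\<tau> \<in> \<Delta>" "\<tau> \<subseteq> \<sigma>" using subface[OF \<sigma>(1)] by (auto simp: \<tau>_def)
  have "(\<Sum>a\<in>\<sigma>. lab a *\<^sub>R V a) = (1 / d) *\<^sub>R (\<Sum>a\<in>\<sigma>. u (V a) *\<^sub>R V a)"
    by (simp add: lab_def scaleR_sum_right)
  also have "\<dots> = X" using u(2) d(1) by (simp add: sum_image_V[OF \<sigma>(1)])
  also have "(\<Sum>a\<in>\<sigma>. lab a *\<^sub>R V a) = (\<Sum>a\<in>\<tau>. lab a *\<^sub>R V a)"
    using faces(2)[OF \<sigma>(1)] by (intro sum.mono_neutral_right) (auto simp: \<tau>_def)
  finally have X_lab: "(\<Sum>a\<in>\<tau>. lab a *\<^sub>R V a) = X" .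
  have flow: "net_flow \<tau> lab l = real_of_int (x l)" if "l \<in> {1..n+1}" for l
    using combination_inner[OF \<tau>(1) that, of lab] X[OF that] X_lab by simp
  have lab_int: "lab a \<in> \<int>" if "a \<in> \<tau>" for a
    using integral_coefficients[OF \<tau>(1) _ that, of lab] flow by simp
  have pos: "lab a > 0" if "a \<in> \<tau>" for a
  proof -
    have "lab a \<ge> 0" using u(1) d(1) that \<tau>(2) by (auto simp: lab_def)
    with that show ?thesis by (auto simp: \<tau>_def)
  qed
  define m where "m a = nat \<lfloor>lab a\<rfloor>" for a
  have m: "real (m a) = lab a" if "a \<in> \<tau>" for a
    using lab_int[OF that] pos[OF that] by (auto simp: m_def elim!: Ints_cases)
  have "net_flow \<tau> (int \<circ> m) l = x l" if "l \<in> {1..n+1}" for l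
  proof -
    have "real_of_int (net_flow \<tau> (int \<circ> m) l) = net_flow \<tau> lab l"
      unfolding net_flow_def of_int_diff of_int_sum comp_apply of_int_of_nat_eq
      using m by (intro arg_cong2[of _ _ _ _ minus] sum.cong) auto
    with flow[OF that] show ?thesis by simp
  qed
  moreover have "m a > 0" if "a \<in> \<tau>" for a
    using m[OF that] pos[OF that] by simp
  ultimately show ?thesis using \<tau>(1) by blast
qed

lemma integer_flow_unique:
  fixes lab lab' :: "arrow \<Rightarrow> nat"
  assumes \<sigma>: "\<sigma> \<in> \<Delta>" and \<tau>: "\<tau> \<in> \<Delta>" and pos: "\<forall>a\<in>\<sigma>. lab a > 0" "\<forall>a\<in>\<tau>. lab' a > 0"
    and eq: "\<forall>l\<in>{1..n+1}. net_flow \<sigma> (int \<circ> lab) l = net_flow \<tau> (int \<circ> lab') l"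
  shows "\<sigma> = \<tau> \<and> (\<forall>a\<in>\<sigma>. lab a = lab' a)"
proof -
  have real: "net_flow \<rho> (\<lambda>a. real (m a)) l = real_of_int (net_flow \<rho> (int \<circ> m) l)" for \<rho> m l
    by (simp add: net_flow_def)
  have "(\<Sum>a\<in>\<sigma>. real (lab a) *\<^sub>R V a) = (\<Sum>a\<in>\<tau>. real (lab' a) *\<^sub>R V a)"
    using combination_inner[OF \<sigma>, of _ "\<lambda>a. real (lab a)"] combination_inner[OF \<tau>, of _ "\<lambda>a. real (lab' a)"] eq
    by (intro e_eqI) (simp add: real)
  from positive_combination_unique[OF \<sigma> \<tau> _ _ this] pos show ?thesis by auto
qed

text \<open>Exchanging the heads of two arrows preserves the sum of their vectors, so uniqueness of
  positive combinations allows at most one of the two pairs as an edge. This turns nesting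
  assumptions into prohibitions of separated or crossing pairs.\<close>

lemma exchange_not_both:
  assumes "{(p, q), (r, s)} \<in> \<Delta>" "{(p, s), (r, q)} \<in> \<Delta>" "p \<noteq> r"
  shows "q = s"
proof (rule ccontr)
  assume "q \<noteq> s"
  have "(\<Sum>a\<in>{(p, q), (r, s)}. 1 *\<^sub>R V a) = (\<Sum>a\<in>{(p, s), (r, q)}. 1 *\<^sub>R V a)"
    using assms(3) by (simp add: arrow_vec_def)
  from positive_combination_unique(1)[OF assms(1,2) _ _ this]
  have "{(p, q), (r, s)} = {(p, s), (r, q)}" by simp
  with \<open>p \<noteq> r\<close> \<open>q \<noteq> s\<close> show False by (auto simp: doubleton_eq_iff)
qed

end

section \<open>Faces in the Simion class\<close>

lemma nesting_pairI:
  assumes "p1 < p2" "p2 < p3" "p3 < p4"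
  shows "nesting_pair [T, H, T, H] (p1, p4) (p3, p2)" "nesting_pair [H, T, H, T] (p4, p1) (p2, p3)"
    "nesting_pair [T, T, H, H] (p1, p4) (p2, p3)" "nesting_pair [H, H, T, T] (p4, p1) (p3, p2)"
  unfolding nesting_pair_def using assms
  by (intro exI[of _ p1] exI[of _ p2] exI[of _ p3] exI[of _ p4];
      simp add: ends_def word_at_def insert_commute)+

lemma crossing_pair_THHT:
  assumes "crossing_pair [T, H, H, T] a b"
  obtains q1 q2 q3 q4 where "q1 < q2" "q2 < q3" "q3 < q4" "{a, b} = {(q1, q3), (q4, q2)}"
proof -
  obtain q1 q2 q3 q4 where q: "q1 < q2" "q2 < q3" "q3 < q4"
    and ends: "{ends a, ends b} = {{q1, q3}, {q2, q4}}"
    and word: "word_at a b [q1, q2, q3, q4] = [T, H, H, T]"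
    using assms unfolding crossing_pair_def by blast
  from word have tails: "q1 \<in> {fst a, fst b}" "q2 \<notin> {fst a, fst b}" "q3 \<notin> {fst a, fst b}" "q4 \<in> {fst a, fst b}"
    by (auto simp: word_at_def split: if_splits)
  obtain a1 a2 b1 b2 where ab: "a = (a1, a2)" "b = (b1, b2)" by (metis prod.exhaust)
  have "{a, b} = {(q1, q3), (q4, q2)}"
    using ends tails q unfolding ab ends_def doubleton_eq_iff fst_conv snd_conv by auto
  with q show ?thesis by (rule that)
qed

lemma crossing_pair_HTTH:
  assumes "crossing_pair [H, T, T, H] a b"
  obtains q1 q2 q3 q4 where "q1 < q2" "q2 < q3" "q3 < q4" "{a, b} = {(q3, q1), (q2, q4)}"
proof -
  obtain q1 q2 q3 q4 where q: "q1 < q2" "q2 < q3" "q3 < q4"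
    and ends: "{ends a, ends b} = {{q1, q3}, {q2, q4}}"
    and word: "word_at a b [q1, q2, q3, q4] = [H, T, T, H]"
    using assms unfolding crossing_pair_def by blast
  from word have tails: "q1 \<notin> {fst a, fst b}" "q2 \<in> {fst a, fst b}" "q3 \<in> {fst a, fst b}" "q4 \<notin> {fst a, fst b}"
    by (auto simp: word_at_def split: if_splits)
  obtain a1 a2 b1 b2 where ab: "a = (a1, a2)" "b = (b1, b2)" by (metis prod.exhaust)
  have "{a, b} = {(q3, q1), (q2, q4)}"
    using ends tails q unfolding ab ends_def doubleton_eq_iff fst_conv snd_conv by auto
  with q show ?thesis by (rule that)
qed

text \<open>With uniformity, one mixed crossing found in a face makes every pair of the same type an
  edge.\<close>

lemma same_order_crossing:
  assumes "p1 < p2" "p2 < p3" "p3 < p4" "q1 < q2" "q2 < q3" "q3 < q4"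
  shows "same_order [p1, p3, p4, p2] [q1, q3, q4, q2]" "same_order [p3, p1, p2, p4] [q3, q1, q2, q4]"
  using assms by (simp_all add: same_order_def less_Suc_eq All_less_Suc numeral_eq_Suc)

context uniform_triangulation
begin

lemmas uniformity = triang[unfolded uniform_flag_triangulation_def uniform_def, THEN conjunct2, THEN conjunct2,
    rule_format]

lemma edge: "{a, b} \<in> \<Delta>" if "\<sigma> \<in> \<Delta>" "a \<in> \<sigma>" "b \<in> \<sigma>"
  using subface[OF that(1)] that(2,3) by simp

lemma nesting_edge: "{a, b} \<in> \<Delta>"
  if "type_nests n \<Delta> W" "nesting_pair W a b" "a \<in> arrows n" "b \<in> arrows n"
  using that by (simp add: type_nests_def)

text \<open>Exchanging heads turns a separated forward pair into a nesting pair of type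
  \<open>THTH\<close>, which is an edge by assumption, so the separated pair is none. A backward
  arrow enclosing a forward one is a nesting pair of type \<open>HTHT\<close>.\<close>

lemma alternating_nonseparated_face:
  assumes nest: "type_nests n \<Delta> [T, H, T, H]" and no_nest: "type_does_not_nest n \<Delta> [H, T, H, T]"
    and \<sigma>: "\<sigma> \<in> \<Delta>"
  shows "alternating_nonseparated \<sigma>"
  unfolding alternating_nonseparated_def
proof (intro conjI allI impI notI)
  fix p q r assume "(p, q) \<in> \<sigma>" "(q, r) \<in> \<sigma>"
  then show False by (rule alternating[OF \<sigma>])
next
  fix p1 p2 p3 p4 assume p: "p1 < p2 \<and> p2 < p3 \<and> p3 < p4" and "(p1, p2) \<in> \<sigma> \<and> (p3, p4) \<in> \<sigma>"
  then have "{(p1, p2), (p3, p4)} \<in> \<Delta>" "(p1, p4) \<in> arrows n" "(p3, p2) \<in> arrows n"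
    using edge[OF \<sigma>] faces(1)[OF \<sigma>] by (auto simp: arrows_def)
  moreover have "nesting_pair [T, H, T, H] (p1, p4) (p3, p2)" using p by (intro nesting_pairI) auto
  ultimately have "p2 = p4"
    using p nesting_edge[OF nest] exchange_not_both[of p1 p2 p3 p4] by simp
  then show False using p by simp
next
  fix p1 p2 p3 p4 assume p: "p1 < p2 \<and> p2 < p3 \<and> p3 < p4" and "(p4, p1) \<in> \<sigma> \<and> (p2, p3) \<in> \<sigma>"
  then have "{(p4, p1), (p2, p3)} \<in> \<Delta>" "(p4, p1) \<in> arrows n" "(p2, p3) \<in> arrows n"
    using edge[OF \<sigma>] faces(1)[OF \<sigma>] by auto
  moreover have "nesting_pair [H, T, H, T] (p4, p1) (p2, p3)" using p by (intro nesting_pairI) auto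
  ultimately show False using no_nest by (auto simp: type_does_not_nest_def)
qed

text \<open>Uniformity promotes the two mixed crossings to the premises of the second Simion
  condition. The resulting nestings of types \<open>TTHH\<close> and \<open>HHTT\<close> are the
  exchange partners of forward and backward crossings, which are thereby excluded.\<close>

lemma crossing_restricted_face:
  assumes simion: "simion_class n \<Delta>" and \<sigma>: "\<sigma> \<in> \<Delta>"
  shows "crossing_restricted \<sigma>"
  unfolding crossing_restricted_def
proof (intro impI allI)
  fix q1 q2 q3 q4 :: nat
  assume ex: "(\<exists>p1 p2 p3 p4. p1 < p2 \<and> p2 < p3 \<and> p3 < p4 \<and> (p1, p3) \<in> \<sigma> \<and> (p4, p2) \<in> \<sigma>) \<and>
      (\<exists>p1 p2 p3 p4. p1 < p2 \<and> p2 < p3 \<and> p3 < p4 \<and> (p3, p1) \<in> \<sigma> \<and> (p2, p4) \<in> \<sigma>)"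
    and q: "q1 < q2 \<and> q2 < q3 \<and> q3 < q4"
  have "type_crosses n \<Delta> [T, H, H, T]"
    unfolding type_crosses_def
  proof (intro ballI impI)
    fix a b assume ab: "a \<in> arrows n" "b \<in> arrows n" and cross: "crossing_pair [T, H, H, T] a b"
    obtain p1 p2 p3 p4 where p: "p1 < p2" "p2 < p3" "p3 < p4" "(p1, p3) \<in> \<sigma>" "(p4, p2) \<in> \<sigma>"
      using ex by blast
    from cross obtain r1 r2 r3 r4 where r: "r1 < r2" "r2 < r3" "r3 < r4" "{a, b} = {(r1, r3), (r4, r2)}"
      by (rule crossing_pair_THHT)
    have "(r1, r3) \<in> arrows n" "(r4, r2) \<in> arrows n" using ab r(4) by (metis insertCI insertE singletonD)+
    moreover have "(p1, p3) \<in> arrows n" "(p4, p2) \<in> arrows n" using p faces(1)[OF \<sigma>] by auto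
    ultimately have "{(p1, p3), (p4, p2)} \<in> \<Delta> \<longleftrightarrow> {(r1, r3), (r4, r2)} \<in> \<Delta>"
      using same_order_crossing(1)[OF p(1-3) r(1-3)] by (intro uniformity) simp_all
    then show "{a, b} \<in> \<Delta>" using edge[OF \<sigma> p(4,5)] r(4) by simp
  qed
  moreover have "type_crosses n \<Delta> [H, T, T, H]"
    unfolding type_crosses_def
  proof (intro ballI impI)
    fix a b assume ab: "a \<in> arrows n" "b \<in> arrows n" and cross: "crossing_pair [H, T, T, H] a b"
    obtain p1 p2 p3 p4 where p: "p1 < p2" "p2 < p3" "p3 < p4" "(p3, p1) \<in> \<sigma>" "(p2, p4) \<in> \<sigma>"
      using ex by blast
    from cross obtain r1 r2 r3 r4 where r: "r1 < r2" "r2 < r3" "r3 < r4" "{a, b} = {(r3, r1), (r2, r4)}"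
      by (rule crossing_pair_HTTH)
    have "(r3, r1) \<in> arrows n" "(r2, r4) \<in> arrows n" using ab r(4) by (metis insertCI insertE singletonD)+
    moreover have "(p3, p1) \<in> arrows n" "(p2, p4) \<in> arrows n" using p faces(1)[OF \<sigma>] by auto
    ultimately have "{(p3, p1), (p2, p4)} \<in> \<Delta> \<longleftrightarrow> {(r3, r1), (r2, r4)} \<in> \<Delta>"
      using same_order_crossing(2)[OF p(1-3) r(1-3)] by (intro uniformity) simp_all
    then show "{a, b} \<in> \<Delta>" using edge[OF \<sigma> p(4,5)] r(4) by simp
  qed
  ultimately have nest: "type_nests n \<Delta> [T, T, H, H]" "type_nests n \<Delta> [H, H, T, T]"
    using simion by (simp_all only: simion_class_def simp_thms)
  have "\<not> ((q1, q3) \<in> \<sigma> \<and> (q2, q4) \<in> \<sigma>)"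
  proof
    assume "(q1, q3) \<in> \<sigma> \<and> (q2, q4) \<in> \<sigma>"
    then have "{(q1, q3), (q2, q4)} \<in> \<Delta>" "(q1, q4) \<in> arrows n" "(q2, q3) \<in> arrows n"
      using edge[OF \<sigma>] faces(1)[OF \<sigma>] q by (auto simp: arrows_def)
    moreover have "nesting_pair [T, T, H, H] (q1, q4) (q2, q3)" using q by (intro nesting_pairI) auto
    ultimately have "q3 = q4"
      using q nesting_edge[OF nest(1)] exchange_not_both[of q1 q3 q2 q4] by simp
    then show False using q by simp
  qed
  moreover have "\<not> ((q3, q1) \<in> \<sigma> \<and> (q4, q2) \<in> \<sigma>)"
  proof
    assume "(q3, q1) \<in> \<sigma> \<and> (q4, q2) \<in> \<sigma>"
    then have "{(q4, q2), (q3, q1)} \<in> \<Delta>" "(q4, q1) \<in> arrows n" "(q3, q2) \<in> arrows n"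
      using edge[OF \<sigma>] faces(1)[OF \<sigma>] q by (auto simp: arrows_def)
    moreover have "nesting_pair [H, H, T, T] (q4, q1) (q3, q2)" using q by (intro nesting_pairI) auto
    ultimately have "q2 = q1"
      using q nesting_edge[OF nest(2)] exchange_not_both[of q4 q2 q3 q1] by simp
    then show False using q by simp
  qed
  ultimately show "\<not> ((q1, q3) \<in> \<sigma> \<and> (q2, q4) \<in> \<sigma>) \<and> \<not> ((q3, q1) \<in> \<sigma> \<and> (q4, q2) \<in> \<sigma>)"
    by blast
qed

section \<open>Facet counts by direction\<close>

lemma card_face_split:
  assumes "\<sigma> \<in> \<Delta>"
  shows "card \<sigma> = card {x\<in>\<sigma>. forward x} + card {x\<in>\<sigma>. backward x}"
proof -
  have "\<sigma> = {x\<in>\<sigma>. forward x} \<union> {x\<in>\<sigma>. backward x}"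
    using faces(1)[OF assms] by (auto simp: arrows_def forward_def backward_def)
  moreover have "{x\<in>\<sigma>. forward x} \<inter> {x\<in>\<sigma>. backward x} = {}"
    by (auto simp: forward_def backward_def)
  ultimately show ?thesis using faces(2)[OF assms] by (metis card_Un_disjoint finite_Un)
qed

lemma full_faces_are_facets:
  assumes "i \<le> n"
  shows "facets \<Delta> \<inter> faces_with \<Delta> i (n - i) = faces_with \<Delta> i (n - i)"
proof -
  have "\<tau> = \<sigma>" if "\<sigma> \<in> faces_with \<Delta> i (n - i)" "\<tau> \<in> \<Delta>" "\<sigma> \<subseteq> \<tau>" for \<sigma> \<tau>
  proof -
    have "\<sigma> \<in> \<Delta>" "card \<sigma> = n"
      using that(1) card_face_split[of \<sigma>] assms by (auto simp: faces_with_def)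
    then show ?thesis
      using card_face_le[OF that(2)] faces(2)[OF that(2)] that(3) card_seteq by metis
  qed
  then show ?thesis by (auto simp: facets_def faces_with_def)
qed

lemma face_enumerator:
  assumes "simion_class n \<Delta>" "type_nests n \<Delta> [T, H, T, H]" "type_does_not_nest n \<Delta> [H, T, H, T]"
  shows "card (peak_pairs n a (M + a)) = (\<Sum>\<sigma>\<in>\<Delta>. card (face_labellings n a M \<sigma>))"
proof (rule card_peak_pairs_faces[OF finite_complex])
  fix \<sigma> assume "\<sigma> \<in> \<Delta>"
  then show "\<sigma> \<subseteq> arrows n \<and> finite \<sigma> \<and> alternating_nonseparated \<sigma> \<and> crossing_restricted \<sigma>"
    using faces assms alternating_nonseparated_face crossing_restricted_face by blast
next
  fix x :: "nat \<Rightarrow> int" assume "(\<Sum>l=1..n+1. x l) = 0"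
  then show "\<exists>\<sigma>\<in>\<Delta>. \<exists>lab :: arrow \<Rightarrow> nat.
      (\<forall>a\<in>\<sigma>. lab a > 0) \<and> (\<forall>l\<in>{1..n+1}. net_flow \<sigma> (int \<circ> lab) l = x l)"
    by (rule integer_flow_exists)
qed (rule integer_flow_unique)

lemma face_number_forward:
  assumes "simion_class n \<Delta>" "type_nests n \<Delta> [T, H, T, H]" "type_does_not_nest n \<Delta> [H, T, H, T]"
    and i: "1 \<le> i" "i \<le> n"
  shows "real (face_number \<Delta> i (n - i)) =
    2 ^ (i - 1) * (real (i + 1) * fact (2 * n - i)) / (fact (n - i) * fact (n + 1))"
  unfolding face_number_def faces_with_def
proof (rule top_counts_from_enumerator[OF finite_complex n_pos _ _ i])
  fix \<sigma> assume "\<sigma> \<in> \<Delta>"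
  then show "card {x\<in>\<sigma>. forward x} + card {x\<in>\<sigma>. backward x} \<le> n"
    using card_face_split card_face_le by metis
next
  fix a M :: nat assume a: "a \<ge> 1"
  have "(\<Sum>\<sigma>\<in>\<Delta>. (if card {x\<in>\<sigma>. forward x} = 0 then 0 else (a - 1) choose (card {x\<in>\<sigma>. forward x} - 1)) *
      ((M + n) choose (n + card {x\<in>\<sigma>. backward x}))) = card (peak_pairs n a (M + a))"
    unfolding face_enumerator[OF assms(1-3)]
    using a by (intro sum.cong refl) (simp add: card_face_labellings[OF faces(2)])
  then show "(\<Sum>\<sigma>\<in>\<Delta>. (if card {x\<in>\<sigma>. forward x} = 0 then 0 else (a - 1) choose (card {x\<in>\<sigma>. forward x} - 1)) *
      ((M + n) choose (n + card {x\<in>\<sigma>. backward x}))) + ((M + n) choose Suc n) * ((M + 2 * a + n) choose (n - 1))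
      = ((M + Suc n) choose Suc n) * ((M + 2 * a + n - 1) choose (n - 1))"
    using card_peak_pairs[OF n_pos a, of M] by (simp only:)
qed

lemma face_number_backward:
  assumes "simion_class n \<Delta>" "type_nests n \<Delta> [T, H, T, H]" "type_does_not_nest n \<Delta> [H, T, H, T]"
  shows "real (face_number \<Delta> 0 n) = catalan n"
proof -
  let ?S = "{\<sigma>\<in>\<Delta>. card {x\<in>\<sigma>. forward x} = 0}"
  have "real (card {\<sigma>\<in>?S. card {x\<in>\<sigma>. backward x} = n}) = real ((2 * n) choose n) / real (n + 1)"
  proof (rule bottom_count_from_enumerator[OF _ n_pos])
    show "finite ?S" using finite_complex by simp
    fix \<sigma> assume "\<sigma> \<in> ?S"
    then have "\<sigma> \<in> \<Delta>" by simp
    then show "card {x\<in>\<sigma>. backward x} \<le> n"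
      using card_face_split card_face_le by fastforce
  next
    fix M
    have "(\<Sum>\<sigma>\<in>?S. (M + n) choose (n + card {x\<in>\<sigma>. backward x})) =
        (\<Sum>\<sigma>\<in>\<Delta>. if card {x\<in>\<sigma>. forward x} = 0 then (M + n) choose (n + card {x\<in>\<sigma>. backward x}) else 0)"
      using finite_complex by (rule sum.inter_filter)
    also have "\<dots> = card (peak_pairs n 0 (M + 0))"
      unfolding face_enumerator[OF assms]
      by (intro sum.cong refl) (simp add: card_face_labellings[OF faces(2)])
    finally show "(\<Sum>\<sigma>\<in>?S. (M + n) choose (n + card {x\<in>\<sigma>. backward x})) +
        ((M + n) choose Suc n) * ((M + n) choose (n - 1)) = ((M + n) choose n)\<^sup>2"
      using card_peak_pairs_0[OF n_pos, of M] by simp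
  qed
  then show ?thesis
    by (simp add: face_number_def faces_with_def catalan_def conj_assoc)
qed

end

theorem theorem7p5:
  fixes n :: nat
    and e :: "nat \<Rightarrow> 'a::euclidean_space"
    and \<Delta> :: "arrow set set"
  assumes "bij_betw e {1..n+1} (Basis :: 'a set)"
    and "uniform_flag_triangulation e n \<Delta>"
    and "simion_class n \<Delta>"
    and "type_nests n \<Delta> [T, H, T, H]"
    and "type_does_not_nest n \<Delta> [H, T, H, T]"
  shows "(\<forall>i. 1 \<le> i \<and> i \<le> n \<longrightarrow>
            card (facets \<Delta> \<inter> faces_with \<Delta> i (n - i)) = face_number \<Delta> i (n - i) \<and>
            real (face_number \<Delta> i (n - i)) =
              2 ^ (i - 1) * (real (i + 1) * fact (2 * n - i)) / (fact (n - i) * fact (n + 1))) \<and>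
         real (card (facets \<Delta> \<inter> faces_with \<Delta> 0 n)) = catalan n"
proof (cases "n = 0")
  case True
  \<comment> \<open>The only face is the empty one, in agreement with the Catalan number 1 for index
    0; the range for \<open>i\<close> is empty.\<close>
  have "arrows 0 = {}" by (auto simp: arrows_def)
  moreover have "abstract_complex (arrows n) \<Delta>"
    using assms(2) by (simp only: uniform_flag_triangulation_def flag_complex_def)
  ultimately have "\<Delta> = {{}}" using True unfolding abstract_complex_def by auto
  then have "facets \<Delta> \<inter> faces_with \<Delta> 0 n = {{}}"
    using True by (auto simp: facets_def faces_with_def)
  then show ?thesis using True by (simp add: catalan_def)
next
  case False
  then interpret uniform_triangulation n e \<Delta>
    using assms(1,2) by unfold_locales auto
  show ?thesis
    using full_faces_are_facets face_number_forward[OF assms(3-5)] full_faces_are_facets[of 0]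
      face_number_backward[OF assms(3-5)]
    by (auto simp: face_number_def)
qed

end
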